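(* Let $I=\{1,\dots,\ell\}$, $J=\{\ell+1,\dots,p\}$, let $h_1,\dots,h_p\colon\mathbb R^n\times\mathbb R^m\to\overline{\mathbb R}$ and $\Gamma(x):=\{y\in\mathbb R^m\mid h_i(x,y)\le0\ (i\in I),\ h_i(x,y)=0\ (i\in J)\}$. Fix $\bar x\in\operatorname{dom}\Gamma$. Assume that $h_1,\dots,h_p$ are continuous and continuously differentiable with respect to $y$ in a neighborhood of $\{\bar x\}\times\Gamma(\bar x)$, that $h_i(x,\cdot)\colon\mathbb R^m\to\mathbb R$ is continuous for every $x\in\operatorname{dom}\Gamma$ and every $i$, and assume (A1): for each $x\in\mathbb R^n$, $h_i(x,\cdot)$ is convex for $i\in I$ and affine for $i\in J$; and (A2): $\Gamma$ is locally bounded at $\bar x$. Suppose that RCPLD holds with respect to $\operatorname{dom}\Gamma$ at each point of $\{\bar x\}\times\Gamma(\bar x)$. Then $\Gamma$ is R-regular with respect to $\operatorname{dom}\Gamma$ at each point of $\{\bar x\}\times\Gamma(\bar x)$.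
   Context: $\operatorname{dom}\Gamma:=\{x\mid\Gamma(x)\ne\emptyset\}$; $\operatorname{dist}(y,A):=\inf_{z\in A}\|z-y\|$ (Euclidean norm). $\Gamma$ is locally bounded at $\bar x$ if there are a bounded set $B$ and a neighborhood $V$ of $\bar x$ with $\Gamma(x)\subset B$ for all $x\in V$. $\Gamma$ is R-regular at $(\bar x,\bar y)$ with respect to $\Omega$ if there exist $\kappa>0$ and a neighborhood $U$ of $(\bar x,\bar y)$ such that $\operatorname{dist}(y,\Gamma(x))\le\kappa\max\{0,\max_{i\in I}h_i(x,y),\max_{i\in J}|h_i(x,y)|\}$ for all $(x,y)\in U\cap(\Omega\times\mathbb R^m)$. A pair of finite families $((a^i)_{i\in I_1},(b^i)_{i\in I_2})$ is positive-linearly dependent if there are scalars $\alpha_i\ge0$ ($i\in I_1$), $\beta_i$ ($i\in I_2$), not all zero, with $\sum\alpha_ia^i+\sum\beta_ib^i=0$. For $(\bar x,\bar y)\in\operatorname{gph}\Gamma$ let $I(\bar x,\bar y):=\{i\in I\mid h_i(\bar x,\bar y)=0\}$. RCPLD holds at $(\bar x,\bar y)$ with respect to $\Omega\subset\mathbb R^n$ if there are a neighborhood $U$ of $(\bar x,\bar y)$ and an index set $S\subset J$ such that: (i) $\{\nabla_yh_i(\bar x,\bar y)\mid i\in S\}$ is a basis of the span of $\{\nabla_yh_i(\bar x,\bar y)\mid i\in J\}$; (ii) the family $(\nabla_yh_i(x,y))_{i\in J}$ has constant rank on $U\cap(\Omega\times\mathbb R^m)$; (iii) for each $K\subset I(\bar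 x,\bar y)$ such that the pair $((\nabla_yh_i(\bar x,\bar y))_{i\in K},(\nabla_yh_i(\bar x,\bar y))_{i\in S})$ is positive-linearly dependent, the family $(\nabla_yh_i(x,y))_{i\in K\cup S}$ is linearly dependent for each $(x,y)\in U\cap(\Omega\times\mathbb R^m)$. *)

theory Defs
  imports "HOL-Analysis.Analysis"
begin


definition Gam :: "(nat \<Rightarrow> real^'n::finite \<Rightarrow> real^'m::finite \<Rightarrow> ereal) \<Rightarrow> nat \<Rightarrow> nat \<Rightarrow> real^'n \<Rightarrow> (real^'m) set" where
  "Gam h l p x = {y. (\<forall>i\<in>{1..l}. h i x y \<le> 0) \<and> (\<forall>i\<in>{l+1..p}. h i x y = 0)}"

definition domG :: "(nat \<Rightarrow> real^'n::finite \<Rightarrow> real^'m::finite \<Rightarrow> ereal) \<Rightarrow> nat \<Rightarrow> nat \<Rightarrow> (real^'n) set" where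
  "domG h l p = {x. Gam h l p x \<noteq> {}}"

text \<open>Partial gradient with respect to y (meaningful where h i x is real-valued and differentiable).\<close>
definition ygrad :: "(nat \<Rightarrow> real^'n::finite \<Rightarrow> real^'m::finite \<Rightarrow> ereal) \<Rightarrow> nat \<Rightarrow> real^'n \<Rightarrow> real^'m \<Rightarrow> real^'m" where
  "ygrad h i x y = (SOME g. ((\<lambda>v. real_of_ereal (h i x v)) has_derivative (\<lambda>v. g \<bullet> v)) (at y))"

definition locally_bounded_at :: "('a::topological_space \<Rightarrow> 'b::metric_space set) \<Rightarrow> 'a \<Rightarrow> bool" where
  "locally_bounded_at G x0 \<longleftrightarrow> (\<exists>B V. bounded B \<and> open V \<and> x0 \<in> V \<and> (\<forall>x\<in>V. G x \<subseteq> B))"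

definition ereal_convex :: "('a::real_vector \<Rightarrow> ereal) \<Rightarrow> bool" where
  "ereal_convex f \<longleftrightarrow> convex {(y, t::real). f y \<le> ereal t}"

definition ereal_affine :: "('a::real_inner \<Rightarrow> ereal) \<Rightarrow> bool" where
  "ereal_affine f \<longleftrightarrow> (\<exists>a b. \<forall>y. f y = ereal (a \<bullet> y + b))"

definition residual :: "(nat \<Rightarrow> real^'n::finite \<Rightarrow> real^'m::finite \<Rightarrow> ereal) \<Rightarrow> nat \<Rightarrow> nat \<Rightarrow> real^'n \<Rightarrow> real^'m \<Rightarrow> ereal" where
  "residual h l p x y = Sup ({0} \<union> {h i x y | i. i \<in> {1..l}} \<union> {\<bar>h i x y\<bar> | i. i \<in> {l+1..p}})"

definition R_regular :: "(nat \<Rightarrow> real^'n::finite \<Rightarrow> real^'m::finite \<Rightarrow> ereal) \<Rightarrow> nat \<Rightarrow> nat \<Rightarrow> (real^'n) set \<Rightarrow> real^'n \<Rightarrow> real^'m \<Rightarrow> bool" where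
  "R_regular h l p \<Omega> x0 y0 \<longleftrightarrow>
     (\<exists>\<kappa>>0. \<exists>U. open U \<and> (x0, y0) \<in> U \<and>
        (\<forall>x y. (x, y) \<in> U \<and> x \<in> \<Omega> \<longrightarrow>
           ereal (infdist y (Gam h l p x)) \<le> ereal \<kappa> * residual h l p x y))"

definition pos_lin_dep :: "(nat \<Rightarrow> 'a::real_vector) \<Rightarrow> nat set \<Rightarrow> (nat \<Rightarrow> 'a) \<Rightarrow> nat set \<Rightarrow> bool" where
  "pos_lin_dep a K b S \<longleftrightarrow> (\<exists>\<alpha> \<beta>. (\<forall>i\<in>K. \<alpha> i \<ge> 0) \<and>
      ((\<exists>i\<in>K. \<alpha> i \<noteq> 0) \<or> (\<exists>i\<in>S. \<beta> i \<noteq> 0)) \<and>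
      (\<Sum>i\<in>K. \<alpha> i *\<^sub>R a i) + (\<Sum>i\<in>S. \<beta> i *\<^sub>R b i) = 0)"

definition fam_lin_dep :: "(nat \<Rightarrow> 'a::real_vector) \<Rightarrow> nat set \<Rightarrow> bool" where
  "fam_lin_dep v A \<longleftrightarrow> (\<exists>c. (\<exists>i\<in>A. c i \<noteq> 0) \<and> (\<Sum>i\<in>A. c i *\<^sub>R v i) = 0)"

definition active :: "(nat \<Rightarrow> real^'n::finite \<Rightarrow> real^'m::finite \<Rightarrow> ereal) \<Rightarrow> nat \<Rightarrow> real^'n \<Rightarrow> real^'m \<Rightarrow> nat set" where
  "active h l x y = {i \<in> {1..l}. h i x y = 0}"

definition RCPLD :: "(nat \<Rightarrow> real^'n::finite \<Rightarrow> real^'m::finite \<Rightarrow> ereal) \<Rightarrow> nat \<Rightarrow> nat \<Rightarrow> (real^'n) set \<Rightarrow> real^'n \<Rightarrow> real^'m \<Rightarrow> bool" where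
  "RCPLD h l p \<Omega> x0 y0 \<longleftrightarrow>
    (\<exists>U S. open U \<and> (x0, y0) \<in> U \<and> S \<subseteq> {l+1..p} \<and>
      \<comment> \<open>(i) basis\<close>
      \<not> fam_lin_dep (\<lambda>i. ygrad h i x0 y0) S \<and>
      span ((\<lambda>i. ygrad h i x0 y0) ` S) = span ((\<lambda>i. ygrad h i x0 y0) ` {l+1..p}) \<and>
      \<comment> \<open>(ii) constant rank\<close>
      (\<exists>r. \<forall>x y. (x, y) \<in> U \<and> x \<in> \<Omega> \<longrightarrow> dim ((\<lambda>i. ygrad h i x y) ` {l+1..p}) = r) \<and>
      \<comment> \<open>(iii)\<close>
      (\<forall>K. K \<subseteq> active h l x0 y0 \<longrightarrow>
         pos_lin_dep (\<lambda>i. ygrad h i x0 y0) K (\<lambda>i. ygrad h i x0 y0) S \<longrightarrow>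
         (\<forall>x y. (x, y) \<in> U \<and> x \<in> \<Omega> \<longrightarrow> fam_lin_dep (\<lambda>i. ygrad h i x y) (K \<union> S))))"

end

theory Submission
  imports Defs
begin

text \<open>If R-regularity fails, there are \<open>x n\<close> in the domain tending to \<open>xb\<close> and points \<open>y n\<close> whose distance to
  \<open>Gam (x n)\<close> exceeds \<open>n\<close> times the residual. Minimising the distance to \<open>y n\<close> plus a quadratic penalty
  gives points \<open>z\<close> arbitrarily close to some \<open>v n\<close> in \<open>Gam (x n)\<close> such that \<open>y n - z\<close> is a combination
  of gradients at \<open>z\<close>, with nonnegative coefficients on violated inequalities only. Along a subsequence
  \<open>v n\<close> tends to some \<open>vb\<close> in \<open>Gam xb\<close>, which need not be the point at which regularity is claimed.
  RCPLD at \<open>vb\<close> allows the multipliers to be chosen bounded by \<open>M * norm (y n - z)\<close>. Taking the inner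
  product with \<open>y n - z\<close> and using the gradient inequality of convex functions, the distance is at most
  \<open>M\<close> times the residual, a contradiction for large \<open>n\<close>.\<close>

section \<open>Positive linear independence and bounds on coefficients\<close>

lemma pos_lin_dep_iff_single:
  assumes "finite K" "finite S" "K \<inter> S = {}"
  shows "pos_lin_dep g K g S \<longleftrightarrow>
    (\<exists>c. (\<forall>i\<in>K. 0 \<le> c i) \<and> (\<exists>i\<in>K \<union> S. c i \<noteq> 0) \<and> (\<Sum>i\<in>K \<union> S. c i *\<^sub>R g i) = 0)"
proof
  assume "pos_lin_dep g K g S"
  then obtain a b where ab: "\<forall>i\<in>K. a i \<ge> 0" "(\<exists>i\<in>K. a i \<noteq> 0) \<or> (\<exists>i\<in>S. b i \<noteq> 0)"
    "(\<Sum>i\<in>K. a i *\<^sub>R g i) + (\<Sum>i\<in>S. b i *\<^sub>R g i) = 0"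
    unfolding pos_lin_dep_def by blast
  define c where "c i = (if i \<in> K then a i else b i)" for i
  have 1: "(\<Sum>i\<in>K. c i *\<^sub>R g i) = (\<Sum>i\<in>K. a i *\<^sub>R g i)"
    by (intro sum.cong) (auto simp: c_def)
  have 2: "(\<Sum>i\<in>S. c i *\<^sub>R g i) = (\<Sum>i\<in>S. b i *\<^sub>R g i)"
    using assms(3) by (intro sum.cong) (auto simp: c_def)
  have "(\<Sum>i\<in>K \<union> S. c i *\<^sub>R g i) = 0"
    using ab(3) assms by (simp add: sum.union_disjoint 1 2)
  moreover have "\<forall>i\<in>K. 0 \<le> c i" "\<exists>i\<in>K \<union> S. c i \<noteq> 0"
    using ab(1,2) assms(3) by (auto simp: c_def)
  ultimately show "\<exists>c. (\<forall>i\<in>K. 0 \<le> c i) \<and> (\<exists>i\<in>K \<union> S. c i \<noteq> 0) \<and> (\<Sum>i\<in>K \<union> S. c i *\<^sub>R g i) = 0"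
    by blast
next
  assume "\<exists>c. (\<forall>i\<in>K. 0 \<le> c i) \<and> (\<exists>i\<in>K \<union> S. c i \<noteq> 0) \<and> (\<Sum>i\<in>K \<union> S. c i *\<^sub>R g i) = 0"
  then obtain c where "\<forall>i\<in>K. 0 \<le> c i" "\<exists>i\<in>K \<union> S. c i \<noteq> 0" "(\<Sum>i\<in>K \<union> S. c i *\<^sub>R g i) = 0"
    by blast
  then show "pos_lin_dep g K g S"
    unfolding pos_lin_dep_def using assms
    by (intro exI[of _ c]) (auto simp: sum.union_disjoint)
qed

text \<open>On the compact set of admissible coefficients with absolute sum 1, the norm of the
  combination is continuous and never zero, so it has a positive minimum \<open>m\<close>.
  Homogeneity carries the bound over to all admissible \<open>c\<close>.\<close>

lemma pos_lin_indep_bound: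
  fixes g :: "nat \<Rightarrow> 'a::real_normed_vector"
  assumes "finite K" "finite S" "K \<inter> S = {}" "\<not> pos_lin_dep g K g S"
  shows "\<exists>m>0. \<forall>c::nat \<Rightarrow> real. (\<forall>i\<in>K. 0 \<le> c i) \<longrightarrow>
    m * (\<Sum>i\<in>K \<union> S. \<bar>c i\<bar>) \<le> norm (\<Sum>i\<in>K \<union> S. c i *\<^sub>R g i)"
proof -
  define A where "A = K \<union> S"
  have fA: "finite A" using assms by (simp add: A_def)
  \<comment> \<open>Coefficients are functions on all of \<open>nat\<close>, so compactness comes
    from Tychonoff's theorem for the box, of which \<open>C\<close> is a closed subset. The
    coordinates outside \<open>A\<close> range freely in the box and affect neither sum.\<close>
  define C where "C = (PiE UNIV (\<lambda>i::nat. {-1..1::real})) \<inter>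
    ({c. (\<Sum>i\<in>A. \<bar>c i\<bar>) = 1} \<inter> {c. \<forall>i\<in>K. 0 \<le> c i})"
  have cont: "continuous_on UNIV (\<lambda>c::nat \<Rightarrow> real. c i)" for i
    by simp
  have "compact (PiE UNIV (\<lambda>i::nat. {-1..1::real}))"
    using compactin_PiE[of "\<lambda>i::nat. euclidean" UNIV "\<lambda>i. {-1..1::real}"]
    by (simp add: euclidean_product_topology)
  moreover have "closed ({c::nat \<Rightarrow> real. (\<Sum>i\<in>A. \<bar>c i\<bar>) = 1} \<inter> {c. \<forall>i\<in>K. 0 \<le> c i})"
    unfolding Ball_def
    by (intro closed_Int closed_Collect_eq closed_Collect_all closed_Collect_imp open_Collect_const
        closed_Collect_le continuous_intros cont)
  ultimately have "compact C"
    unfolding C_def by (rule compact_Int_closed)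
  have contn: "continuous_on C (\<lambda>c. norm (\<Sum>i\<in>A. c i *\<^sub>R g i))"
    by (intro continuous_intros continuous_on_subset[OF cont]) auto
  obtain m where m: "m > 0" "\<And>c. c \<in> C \<Longrightarrow> m \<le> norm (\<Sum>i\<in>A. c i *\<^sub>R g i)"
  \<comment> \<open>\<open>C\<close> is empty exactly when \<open>A\<close> is; any positive
    constant then serves.\<close>
  proof (cases "C = {}")
    case False
    obtain c0 where c0: "c0 \<in> C" "\<And>c. c \<in> C \<Longrightarrow>
        norm (\<Sum>i\<in>A. c0 i *\<^sub>R g i) \<le> norm (\<Sum>i\<in>A. c i *\<^sub>R g i)"
      using continuous_attains_inf[OF \<open>compact C\<close> False contn] by blast
    have "\<exists>i\<in>A. c0 i \<noteq> 0"
    proof (rule ccontr)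
      assume "\<not> ?thesis"
      then have "(\<Sum>i\<in>A. \<bar>c0 i\<bar>) = 0" by simp
      with c0(1) show False by (simp add: C_def)
    qed
    then have "(\<Sum>i\<in>A. c0 i *\<^sub>R g i) \<noteq> 0"
      using assms(4) c0(1) unfolding pos_lin_dep_iff_single[OF assms(1-3)] A_def C_def by auto
    with c0(2) show ?thesis by (intro that[of "norm (\<Sum>i\<in>A. c0 i *\<^sub>R g i)"]) auto
  qed (use that[of 1] in auto)
  have "m * (\<Sum>i\<in>A. \<bar>c i\<bar>) \<le> norm (\<Sum>i\<in>A. c i *\<^sub>R g i)" if c: "\<forall>i\<in>K. 0 \<le> c i" for c
  proof -
    define s where "s = (\<Sum>i\<in>A. \<bar>c i\<bar>)"
    have "s \<ge> 0" by (simp add: s_def sum_nonneg)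
    show ?thesis
    proof (cases "s = 0")
      case False
      \<comment> \<open>Normalised coefficients, set to 0 outside \<open>A\<close> so that they stay
        in the box.\<close>
      define d where "d i = (if i \<in> A then c i / s else 0)" for i
      have le: "\<bar>c i\<bar> \<le> s" if "i \<in> A" for i
        unfolding s_def using fA that by (intro member_le_sum) auto
      have "d i \<in> {-1..1}" for i
        using le[of i] \<open>s \<ge> 0\<close> False by (auto simp: d_def field_simps abs_le_iff)
      moreover have "(\<Sum>i\<in>A. \<bar>d i\<bar>) = 1"
        using False \<open>s \<ge> 0\<close> by (simp add: d_def sum_divide_distrib[symmetric] s_def[symmetric])
      ultimately have "d \<in> C"
        using c \<open>s \<ge> 0\<close> by (auto simp: C_def d_def)
      then have "m \<le> norm (\<Sum>i\<in>A. d i *\<^sub>R g i)" by (rule m(2))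
      also have "(\<Sum>i\<in>A. d i *\<^sub>R g i) = (1 / s) *\<^sub>R (\<Sum>i\<in>A. c i *\<^sub>R g i)"
        by (simp add: d_def scaleR_right.sum)
      finally show ?thesis
        using False \<open>s \<ge> 0\<close> by (simp add: field_simps s_def[symmetric])
    qed (simp add: s_def)
  qed
  with m(1) show ?thesis unfolding A_def by blast
qed

text \<open>Moving each vector by less than \<open>m / 2\<close> changes a combination by at most
  half of the lower bound \<open>m\<close> times the absolute sum. The other half survives, which
  gives the constant \<open>2 / m\<close> for all \<open>c\<close> at once.\<close>

lemma pos_lin_indep_bound_eventually:
  fixes G :: "nat \<Rightarrow> 'b::topological_space \<Rightarrow> 'a::real_normed_vector"
  assumes "finite K" "finite S" "K \<inter> S = {}"
    and indep: "\<not> pos_lin_dep (\<lambda>i. G i z0) K (\<lambda>i. G i z0) S"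
    and cont: "\<And>i. i \<in> K \<union> S \<Longrightarrow> (G i \<longlongrightarrow> G i z0) (nhds z0)"
  shows "\<exists>M>0. \<forall>\<^sub>F z in nhds z0. \<forall>c::nat \<Rightarrow> real. (\<forall>i\<in>K. 0 \<le> c i) \<longrightarrow>
    (\<Sum>i\<in>K \<union> S. \<bar>c i\<bar>) \<le> M * norm (\<Sum>i\<in>K \<union> S. c i *\<^sub>R G i z)"
proof -
  obtain m where m: "m > 0" "\<And>c. (\<forall>i\<in>K. 0 \<le> c i) \<Longrightarrow>
      m * (\<Sum>i\<in>K \<union> S. \<bar>c i\<bar>) \<le> norm (\<Sum>i\<in>K \<union> S. c i *\<^sub>R G i z0)"
    using pos_lin_indep_bound[OF assms(1-4)] by blast
  have "\<forall>\<^sub>F z in nhds z0. \<forall>i\<in>K \<union> S. dist (G i z) (G i z0) < m / 2"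
    using assms(1,2) m(1) cont by (intro eventually_ball_finite ballI tendstoD) auto
  then have "\<forall>\<^sub>F z in nhds z0. \<forall>c::nat \<Rightarrow> real. (\<forall>i\<in>K. 0 \<le> c i) \<longrightarrow>
    (\<Sum>i\<in>K \<union> S. \<bar>c i\<bar>) \<le> 2 / m * norm (\<Sum>i\<in>K \<union> S. c i *\<^sub>R G i z)"
  proof (rule eventually_mono, intro allI impI)
    fix z and c :: "nat \<Rightarrow> real"
    assume z: "\<forall>i\<in>K \<union> S. dist (G i z) (G i z0) < m / 2" and c: "\<forall>i\<in>K. 0 \<le> c i"
    let ?s = "\<Sum>i\<in>K \<union> S. \<bar>c i\<bar>"
    let ?w = "\<lambda>z. \<Sum>i\<in>K \<union> S. c i *\<^sub>R G i z"
    have "norm (?w z0 - ?w z) = norm (\<Sum>i\<in>K \<union> S. c i *\<^sub>R (G i z0 - G i z))"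
      by (simp add: sum_subtractf scaleR_diff_right)
    also have "\<dots> \<le> (\<Sum>i\<in>K \<union> S. \<bar>c i\<bar> * (m / 2))"
    proof (intro order.trans[OF norm_sum] sum_mono)
      fix i assume "i \<in> K \<union> S"
      then have "norm (G i z0 - G i z) \<le> m / 2"
        using z by (auto simp: dist_norm norm_minus_commute less_imp_le)
      then show "norm (c i *\<^sub>R (G i z0 - G i z)) \<le> \<bar>c i\<bar> * (m / 2)"
        by (simp only: norm_scaleR mult_left_mono abs_ge_zero)
    qed
    finally have "norm (?w z0 - ?w z) \<le> ?s * (m / 2)"
      by (simp only: sum_distrib_right)
    moreover have "norm (?w z0) \<le> norm (?w z) + norm (?w z0 - ?w z)"
      by (rule norm_triangle_sub)
    moreover have "?s * (m / 2) = m * ?s / 2"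
      by (simp only: times_divide_eq_right mult.commute)
    ultimately have "m * ?s \<le> 2 * norm (?w z)"
      using m(2)[OF c] by linarith
    then have "?s \<le> (2 * norm (?w z)) / m"
      using m(1) by (simp only: pos_le_divide_eq mult.commute)
    then show "?s \<le> 2 / m * norm (?w z)"
      by (simp only: times_divide_eq_left)
  qed
  then show ?thesis using m(1) by (intro exI[of _ "2 / m"]) auto
qed

section \<open>Linearly independent families and reduction of combinations\<close>

lemma fam_lin_dep_mono:
  assumes "fam_lin_dep v A" "A \<subseteq> B" "finite B"
  shows "fam_lin_dep v B"
proof -
  obtain c where c: "\<exists>i\<in>A. c i \<noteq> 0" "(\<Sum>i\<in>A. c i *\<^sub>R v i) = 0"
    using assms(1) unfolding fam_lin_dep_def by blast
  have "(\<Sum>i\<in>B. (if i \<in> A then c i else 0) *\<^sub>R v i) = (\<Sum>i\<in>A. c i *\<^sub>R v i)"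
    using assms(2,3) by (intro sum.mono_neutral_cong_right) auto
  also note c(2)
  finally have "(\<Sum>i\<in>B. (if i \<in> A then c i else 0) *\<^sub>R v i) = 0" .
  moreover have "\<exists>i\<in>B. (if i \<in> A then c i else 0) \<noteq> 0"
    using c(1) assms(2) by auto
  ultimately show ?thesis
    unfolding fam_lin_dep_def by (intro exI[of _ "\<lambda>i. if i \<in> A then c i else 0"] conjI)
qed

text \<open>Families may repeat a vector, sets cannot. A repetition is itself a dependence, so an
  independent family is injective and facts on independent sets, dimension and cardinality apply to
  its image.\<close>

lemma not_fam_lin_depD:
  assumes "\<not> fam_lin_dep v A" "finite A"
  shows "inj_on v A" "independent (v ` A)"
proof -
  show inj: "inj_on v A"
  proof (rule inj_onI, rule ccontr)
    fix i j assume ij: "i \<in> A" "j \<in> A" "v i = v j" "i \<noteq> j"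
    have "(\<Sum>k\<in>{i, j}. (if k = i then 1 else - 1) *\<^sub>R v k) = 0"
      using ij by simp
    then have "fam_lin_dep v {i, j}"
      unfolding fam_lin_dep_def
      by (intro exI[of _ "\<lambda>k. if k = i then 1 else - 1"] conjI bexI[of _ i]) simp_all
    then have "fam_lin_dep v A" by (rule fam_lin_dep_mono) (use ij assms in auto)
    with assms show False by simp
  qed
  show "independent (v ` A)"
  proof (rule independent_if_scalars_zero)
    fix f x assume f: "(\<Sum>x\<in>v ` A. f x *\<^sub>R x) = 0" and x: "x \<in> v ` A"
    have "(\<Sum>i\<in>A. f (v i) *\<^sub>R v i) = 0"
      using f by (simp add: sum.reindex[OF inj])
    moreover have "\<exists>i\<in>A. f (v i) \<noteq> 0" if "f x \<noteq> 0"
      using that x by blast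
    ultimately have "fam_lin_dep v A" if "f x \<noteq> 0"
      unfolding fam_lin_dep_def using that by (intro exI[of _ "\<lambda>i. f (v i)"] conjI)
    with assms(1) show "f x = 0" by blast
  qed (use assms in auto)
qed

text \<open>Reduction of a conic combination in the style of Caratheodory: only the conic part \<open>A\<close> shrinks,
  the independent family \<open>S\<close> is kept whole.\<close>

lemma conic_caratheodory:
  fixes g :: "nat \<Rightarrow> 'a::real_vector"
  assumes "finite A" "finite S" "A \<inter> S = {}" "\<not> fam_lin_dep g S" "\<forall>i\<in>A. 0 \<le> c i"
  shows "\<exists>K\<subseteq>A. \<exists>d. \<not> fam_lin_dep g (K \<union> S) \<and> (\<forall>i\<in>K. 0 \<le> d i) \<and>
    (\<Sum>i\<in>K \<union> S. d i *\<^sub>R g i) = (\<Sum>i\<in>A \<union> S. c i *\<^sub>R g i)"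
  using assms
proof (induction "card A" arbitrary: A c rule: less_induct)
  case less
  show ?case
  proof (cases "fam_lin_dep g (A \<union> S)")
    case False
    then show ?thesis using less.prems by blast
  next
    case True
    then obtain e0 where e0: "\<exists>i\<in>A \<union> S. e0 i \<noteq> 0" "(\<Sum>i\<in>A \<union> S. e0 i *\<^sub>R g i) = 0"
      unfolding fam_lin_dep_def by blast
    \<comment> \<open>A dependence supported on \<open>S\<close> alone would contradict the
      independence of \<open>S\<close>.\<close>
    have "\<exists>i\<in>A. e0 i \<noteq> 0"
    proof (rule ccontr)
      assume neg: "\<not> ?thesis"
      then have "(\<Sum>i\<in>A \<union> S. e0 i *\<^sub>R g i) = (\<Sum>i\<in>S. e0 i *\<^sub>R g i)"
        using less.prems by (intro sum.mono_neutral_right) auto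
      with e0 neg have "\<exists>i\<in>S. e0 i \<noteq> 0" "(\<Sum>i\<in>S. e0 i *\<^sub>R g i) = 0" by auto
      then have "fam_lin_dep g S" unfolding fam_lin_dep_def by (intro exI[of _ e0] conjI)
      with less.prems(4) show False by blast
    qed
    then obtain i0 where i0: "i0 \<in> A" "e0 i0 \<noteq> 0" by blast
    \<comment> \<open>The sign is chosen to make \<open>e\<close> positive at \<open>i0\<close>, so
      that the set \<open>P\<close> of the ratio test is nonempty.\<close>
    define e where "e i = sgn (e0 i0) * e0 i" for i
    have e: "(\<Sum>i\<in>A \<union> S. e i *\<^sub>R g i) = 0" "e i0 > 0"
      using e0(2) i0(2) by (auto simp: e_def scaleR_scaleR[symmetric] scaleR_right.sum[symmetric]
          sgn_if simp del: scaleR_scaleR)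
    define P where "P = {i\<in>A. e i > 0}"
    have "finite P" "P \<noteq> {}" using less.prems(1) i0 e(2) by (auto simp: P_def)
    \<comment> \<open>The largest multiple of \<open>e\<close> that can be subtracted from
      \<open>c\<close> without making a coefficient on \<open>A\<close> negative. An index attaining
      the minimum gets coefficient 0 and leaves \<open>A\<close>.\<close>
    define t where "t = Min ((\<lambda>i. c i / e i) ` P)"
    have "t \<in> (\<lambda>i. c i / e i) ` P"
      unfolding t_def using \<open>finite P\<close> \<open>P \<noteq> {}\<close> by (intro Min_in) auto
    then obtain i1 where i1: "i1 \<in> P" "t = c i1 / e i1" by blast
    have t_le: "t \<le> c i / e i" if "i \<in> P" for i
      unfolding t_def using \<open>finite P\<close> that by (intro Min_le) auto
    have "t \<ge> 0" using i1 less.prems(5) by (auto simp: P_def)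
    define d where "d i = c i - t * e i" for i
    have "d i \<ge> 0" if "i \<in> A" for i
    proof (cases "i \<in> P")
      case True
      then show ?thesis using t_le[OF True] by (auto simp: d_def P_def field_simps)
    next
      case False
      then have "t * e i \<le> 0" using that \<open>t \<ge> 0\<close> by (auto simp: P_def mult_nonneg_nonpos)
      then show ?thesis using less.prems(5) that by (auto simp: d_def intro: order_trans)
    qed
    moreover have "d i1 = 0" using i1 by (auto simp: d_def P_def)
    have "card (A - {i1}) < card A"
      using i1 less.prems(1) by (intro psubset_card_mono) (auto simp: P_def)
    ultimately obtain K f where K: "K \<subseteq> A - {i1}" "\<not> fam_lin_dep g (K \<union> S)" "\<forall>i\<in>K. 0 \<le> f i"
      "(\<Sum>i\<in>K \<union> S. f i *\<^sub>R g i) = (\<Sum>i\<in>(A - {i1}) \<union> S. d i *\<^sub>R g i)"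
      using less.hyps[of "A - {i1}" d] less.prems by blast
    have "(\<Sum>i\<in>(A - {i1}) \<union> S. d i *\<^sub>R g i) = (\<Sum>i\<in>A \<union> S. d i *\<^sub>R g i)"
      using less.prems \<open>d i1 = 0\<close> by (intro sum.mono_neutral_left) auto
    also have "\<dots> = (\<Sum>i\<in>A \<union> S. c i *\<^sub>R g i) - t *\<^sub>R (\<Sum>i\<in>A \<union> S. e i *\<^sub>R g i)"
      by (simp add: d_def scaleR_diff_left sum_subtractf scaleR_right.sum)
    finally show ?thesis using K e(1) by (intro exI[of _ K] conjI exI[of _ f]) auto
  qed
qed

text \<open>Induction on the span: a new multiple of \<open>g i\<close> is added to the coefficient
  at one chosen index \<open>i\<close>, so coefficients belong to indices rather than to
  vectors.\<close>

lemma span_image_combination: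
  assumes "finite S" "w \<in> span (g ` S)"
  shows "\<exists>c. w = (\<Sum>i\<in>S. c i *\<^sub>R g i)"
  using assms(2,1)
proof (induction rule: span_induct_alt)
  case base
  show ?case by (intro exI[of _ "\<lambda>_. 0"]) simp
next
  case (step a x y)
  then obtain i c where i: "i \<in> S" "x = g i" "y = (\<Sum>i\<in>S. c i *\<^sub>R g i)" by blast
  have "(\<Sum>j\<in>S. (c j + (if j = i then a else 0)) *\<^sub>R g j)
    = y + (\<Sum>j\<in>S. if j = i then a *\<^sub>R g j else 0)"
    unfolding i(3) sum.distrib[symmetric] by (intro sum.cong) (auto simp: algebra_simps)
  then show ?case using i step.prems by (intro exI[of _ "\<lambda>j. c j + (if j = i then a else 0)"]) (simp add: add.commute)
qed

section \<open>Gradient inequality, penalised projection and limits of feasible points\<close>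

lemma convex_gradient_inequality:
  fixes f :: "'a::real_inner \<Rightarrow> real"
  assumes "convex_on UNIV f" "(f has_derivative (\<lambda>u. g \<bullet> u)) (at z)"
  shows "f z + g \<bullet> (y - z) \<le> f y"
proof -
  \<comment> \<open>Restriction to the line through \<open>z\<close> and \<open>y\<close> reduces
    the claim to the tangent inequality for a convex function of one real variable, at 0 and
    1.\<close>
  define k where "k t = f (z + t *\<^sub>R (y - z))" for t
  have eq: "z + ((1 - t) *\<^sub>R a + t *\<^sub>R b) *\<^sub>R (y - z)
      = (1 - t) *\<^sub>R (z + a *\<^sub>R (y - z)) + t *\<^sub>R (z + b *\<^sub>R (y - z))" for t a b :: real
    by (simp add: algebra_simps)
  have "convex_on UNIV k"
  proof (rule convex_onI)
    fix t a b :: real assume "0 < t" "t < 1"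
    then show "k ((1 - t) *\<^sub>R a + t *\<^sub>R b) \<le> (1 - t) * k a + t * k b"
      unfolding k_def eq by (intro convex_onD[OF assms(1)]) auto
  qed auto
  moreover have "(k has_real_derivative g \<bullet> (y - z)) (at 0)"
  proof -
    have "((\<lambda>t::real. z + t *\<^sub>R (y - z)) has_derivative (\<lambda>t. t *\<^sub>R (y - z))) (at 0)"
      by (auto intro!: derivative_eq_intros)
    moreover have "(f has_derivative (\<lambda>u. g \<bullet> u)) (at (z + 0 *\<^sub>R (y - z)))"
      using assms(2) by simp
    ultimately have "((\<lambda>t. f (z + t *\<^sub>R (y - z))) has_derivative (\<lambda>t. g \<bullet> (t *\<^sub>R (y - z)))) (at 0)"
      by (rule has_derivative_compose)
    moreover have "(\<lambda>t. g \<bullet> (t *\<^sub>R (y - z))) = (*) (g \<bullet> (y - z))"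
      by (auto simp: fun_eq_iff)
    ultimately show ?thesis
      unfolding k_def has_field_derivative_def by simp
  qed
  ultimately have "k 1 - k 0 \<ge> (g \<bullet> (y - z)) * (1 - 0)"
    by (intro convex_on_imp_above_tangent[where A = UNIV]) auto
  then show ?thesis by (simp add: k_def)
qed

text \<open>The \<open>z n\<close> are (a subsequence of) minimisers of the distance to \<open>y\<close> plus a growing quadratic
  penalty for the constraints; no constraint qualification is needed for their stationarity.\<close>

lemma penalty_stationary_sequence:
  fixes f :: "nat \<Rightarrow> 'a::euclidean_space \<Rightarrow> real" and y v0 :: 'a
  assumes fin: "finite I" "finite J" "I \<inter> J = {}"
    and cont: "\<And>i. i \<in> I \<union> J \<Longrightarrow> continuous_on UNIV (f i)"
    and v0: "\<forall>i\<in>I. f i v0 \<le> 0" "\<forall>i\<in>J. f i v0 = 0"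
  shows "\<exists>v z. (\<forall>i\<in>I. f i v \<le> 0) \<and> (\<forall>i\<in>J. f i v = 0) \<and> z \<longlonglongrightarrow> v \<and>
    (\<forall>n g. (\<forall>i\<in>I \<union> J. (f i has_derivative (\<lambda>u. g i \<bullet> u)) (at (z n))) \<longrightarrow>
      (\<exists>A\<subseteq>I. \<exists>c. (\<forall>i\<in>A. 0 \<le> c i \<and> 0 < f i (z n)) \<and> y - z n = (\<Sum>i\<in>A \<union> J. c i *\<^sub>R g i)))"
proof -
  define P where "P w = (\<Sum>i\<in>I. (max 0 (f i w))\<^sup>2) + (\<Sum>i\<in>J. (f i w)\<^sup>2)" for w
  define \<phi> where "\<phi> n w = (norm (w - y))\<^sup>2 + real (Suc n) * P w" for n w
  define D where "D = norm (v0 - y)"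
  have P0: "0 \<le> P w" for w by (simp add: P_def sum_nonneg)
  have "(\<Sum>i\<in>I. (max 0 (f i v0))\<^sup>2) = 0"
    using v0 by (intro sum.neutral) auto
  then have Pv0: "P v0 = 0" using v0 by (simp add: P_def)
  have contP: "continuous_on UNIV P"
    unfolding P_def using cont by (intro continuous_intros) auto
  have "0 \<le> D" by (simp add: D_def)
  \<comment> \<open>The feasible point \<open>v0\<close> has penalised value
    \<open>D\<^sup>2\<close>, so minimisers lie within \<open>D\<close> of \<open>y\<close>. The
    radius \<open>D + 1\<close> therefore keeps them in the interior of the ball.\<close>
  then have "\<exists>z\<in>cball y (D + 1). \<forall>w\<in>cball y (D + 1). \<phi> n z \<le> \<phi> n w" for n
    using contP unfolding \<phi>_def
    by (intro continuous_attains_inf continuous_intros) (auto intro: continuous_on_subset)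
  then obtain z0 where z0: "\<And>n. z0 n \<in> cball y (D + 1)"
    "\<And>n w. w \<in> cball y (D + 1) \<Longrightarrow> \<phi> n (z0 n) \<le> \<phi> n w"
    by metis
  have le: "(norm (z0 n - y))\<^sup>2 + real (Suc n) * P (z0 n) \<le> D\<^sup>2" for n
    using z0(2)[of v0 n] Pv0 by (simp add: \<phi>_def D_def dist_norm norm_minus_commute)
  have zD: "norm (z0 n - y) \<le> D" for n
  proof -
    have "0 \<le> real (Suc n) * P (z0 n)" using P0 by simp
    with le[of n] have "(norm (z0 n - y))\<^sup>2 \<le> D\<^sup>2" by linarith
    then show ?thesis by (rule power2_le_imp_le) (simp add: D_def)
  qed
  have stat: "\<exists>A\<subseteq>I. \<exists>c. (\<forall>i\<in>A. 0 \<le> c i \<and> 0 < f i (z0 n)) \<and> y - z0 n = (\<Sum>i\<in>A \<union> J. c i *\<^sub>R g i)"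
    if g: "\<forall>i\<in>I \<union> J. (f i has_derivative (\<lambda>u. g i \<bullet> u)) (at (z0 n))" for n g
  proof -
    define z where "z = z0 n"
    \<comment> \<open>\<open>I0\<close> collects the inequalities violated or active at
      \<open>z\<close>. The others are strictly negative at \<open>z\<close> and, by continuity, on
      the open set \<open>O1\<close>, so they add no penalty there.\<close>
    define I0 where "I0 = {i\<in>I. 0 \<le> f i z}"
    define O1 where "O1 = ball y (D + 1) \<inter> (\<Inter>i\<in>I - I0. {w. f i w < 0})"
    \<comment> \<open>\<open>\<psi>\<close> majorises the penalised objective near \<open>z\<close> and touches it there, which
      avoids differentiating the positive part\<close>
    define \<psi> where "\<psi> w = (w - y) \<bullet> (w - y) + real (Suc n) * (\<Sum>i\<in>I0 \<union> J. (f i w)\<^sup>2)" for w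
    have fI0: "finite I0" "I0 \<inter> J = {}" "I0 \<subseteq> I" using fin by (auto simp: I0_def)
    have "open O1"
      unfolding O1_def using fin cont
      by (intro open_Int open_INT ballI open_Collect_less continuous_intros) auto
    moreover have "z \<in> O1"
      using zD[of n] by (auto simp: O1_def I0_def z_def dist_norm norm_minus_commute)
    moreover have "\<psi> z \<le> \<psi> w" if w: "w \<in> O1" for w
    proof -
      have splitI: "(\<Sum>i\<in>I. q i) = (\<Sum>i\<in>I0. q i) + (\<Sum>i\<in>I - I0. q i)" for q :: "nat \<Rightarrow> real"
        using fin(1) fI0 by (simp add: sum.subset_diff add.commute)
      have "P w \<le> (\<Sum>i\<in>I0 \<union> J. (f i w)\<^sup>2)"
      proof -
        have "(\<Sum>i\<in>I - I0. (max 0 (f i w))\<^sup>2) = 0"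
          using w by (intro sum.neutral) (auto simp: O1_def)
        moreover have "(\<Sum>i\<in>I0. (max 0 (f i w))\<^sup>2) \<le> (\<Sum>i\<in>I0. (f i w)\<^sup>2)"
          by (intro sum_mono) (auto simp: max_def)
        ultimately show ?thesis
          unfolding P_def splitI using fin fI0 by (simp add: sum.union_disjoint)
      qed
      moreover have "P z = (\<Sum>i\<in>I0 \<union> J. (f i z)\<^sup>2)"
      proof -
        have "(\<Sum>i\<in>I - I0. (max 0 (f i z))\<^sup>2) = 0"
          by (intro sum.neutral) (auto simp: I0_def)
        moreover have "(\<Sum>i\<in>I0. (max 0 (f i z))\<^sup>2) = (\<Sum>i\<in>I0. (f i z)\<^sup>2)"
          by (intro sum.cong) (auto simp: I0_def)
        ultimately show ?thesis
          unfolding P_def splitI using fin fI0 by (simp add: sum.union_disjoint)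
      qed
      ultimately have "\<psi> z = \<phi> n z" "\<phi> n w \<le> \<psi> w"
        by (auto simp: \<psi>_def \<phi>_def power2_norm_eq_inner intro!: mult_left_mono)
      moreover have "\<phi> n z \<le> \<phi> n w"
        using w z0(2)[of w n] by (simp add: z_def O1_def less_imp_le)
      ultimately show ?thesis by linarith
    qed
    moreover have "(\<psi> has_derivative (\<lambda>u. 2 * ((z - y) \<bullet> u) +
        real (Suc n) * (\<Sum>i\<in>I0 \<union> J. 2 * f i z * (g i \<bullet> u)))) (at z)"
    proof -
      have 1: "((\<lambda>w. (f i w)\<^sup>2) has_derivative (\<lambda>u. 2 * f i z * (g i \<bullet> u))) (at z)"
        if "i \<in> I0 \<union> J" for i
      proof -
        have "(f i has_derivative (\<lambda>u. g i \<bullet> u)) (at z)"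
          using g that fI0 by (auto simp: z_def)
        from has_derivative_power[OF this, of 2] show ?thesis by (simp add: mult_ac)
      qed
      have 2: "((\<lambda>w. (w - y) \<bullet> (w - y)) has_derivative (\<lambda>u. 2 * ((z - y) \<bullet> u))) (at z)"
        by (auto intro!: derivative_eq_intros simp: inner_commute)
      show ?thesis
        unfolding \<psi>_def by (intro has_derivative_add 2 has_derivative_mult_right has_derivative_sum 1)
    qed
    ultimately have "(\<lambda>u. 2 * ((z - y) \<bullet> u) +
        real (Suc n) * (\<Sum>i\<in>I0 \<union> J. 2 * f i z * (g i \<bullet> u))) = (\<lambda>u. 0)"
      by (intro differential_zero_maxmin[of z O1 \<psi>]) auto
    then have zero: "2 * ((z - y) \<bullet> u) + real (Suc n) * (\<Sum>i\<in>I0 \<union> J. 2 * f i z * (g i \<bullet> u)) = 0" for u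
      by (rule fun_cong)
    \<comment> \<open>Half of the stationarity equation gives these multipliers. They are positive
      on violated inequalities and vanish on active ones, so \<open>I0\<close> can be cut down to
      the violated ones below.\<close>
    define c where "c i = real (Suc n) * f i z" for i
    have "(y - z - (\<Sum>i\<in>I0 \<union> J. c i *\<^sub>R g i)) \<bullet> u = 0" for u
    proof -
      have "(\<Sum>i\<in>I0 \<union> J. c i *\<^sub>R g i) \<bullet> u = (\<Sum>i\<in>I0 \<union> J. c i * (g i \<bullet> u))"
        by (simp add: inner_sum_left)
      also have "2 * \<dots> = real (Suc n) * (\<Sum>i\<in>I0 \<union> J. 2 * f i z * (g i \<bullet> u))"
        unfolding sum_distrib_left c_def by (intro sum.cong) auto
      finally show ?thesis using zero[of u] by (simp add: inner_diff_left)
    qed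
    then have "y - z = (\<Sum>i\<in>I0 \<union> J. c i *\<^sub>R g i)"
      by (metis eq_iff_diff_eq_0 inner_eq_zero_iff)
    also have "\<dots> = (\<Sum>i\<in>{i\<in>I. 0 < f i z} \<union> J. c i *\<^sub>R g i)"
      using fin by (intro sum.mono_neutral_right) (auto simp: I0_def c_def)
    finally show ?thesis
      by (intro exI[of _ "{i\<in>I. 0 < f i z}"] conjI exI[of _ c]) (auto simp: c_def z_def)
  qed
  have "seq_compact (cball y (D + 1))" by (simp add: compact_imp_seq_compact)
  then obtain v r where r: "strict_mono r" "(z0 \<circ> r) \<longlonglongrightarrow> v"
    using z0(1) unfolding seq_compact_def by metis
  have "(\<lambda>n. P ((z0 \<circ> r) n)) \<longlonglongrightarrow> P v"
    by (rule continuous_on_tendsto_compose[OF contP r(2)]) auto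
  moreover have "(\<lambda>n. D\<^sup>2 / real (Suc (r n))) \<longlonglongrightarrow> 0"
    using LIMSEQ_subseq_LIMSEQ[OF LIMSEQ_Suc[OF lim_const_over_n[of "D\<^sup>2"]] r(1)]
    by (simp add: o_def)
  \<comment> \<open>The penalty weight forces the violation to 0 along the minimisers, so every
    cluster point is feasible.\<close>
  moreover have "P (z0 n) \<le> D\<^sup>2 / real (Suc n)" for n
  proof -
    have "real (Suc n) * P (z0 n) \<le> D\<^sup>2"
      using le[of n] zero_le_power2[of "norm (z0 n - y)"] by linarith
    then show ?thesis by (simp add: pos_le_divide_eq mult.commute)
  qed
  ultimately have "P v \<le> 0"
    by (intro LIMSEQ_le) (auto simp: o_def)
  then have "(\<Sum>i\<in>I. (max 0 (f i v))\<^sup>2) = 0" "(\<Sum>i\<in>J. (f i v)\<^sup>2) = 0"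
    using sum_nonneg[of I "\<lambda>i. (max 0 (f i v))\<^sup>2"] sum_nonneg[of J "\<lambda>i. (f i v)\<^sup>2"]
    unfolding P_def by auto
  then have "\<forall>i\<in>I. f i v \<le> 0" "\<forall>i\<in>J. f i v = 0"
    using fin by (auto simp: sum_nonneg_eq_0_iff max_def split: if_splits)
  then show ?thesis
    using r(2) stat by (intro exI[of _ v] exI[of _ "z0 \<circ> r"]) auto
qed

text \<open>The inner product of the representation with \<open>y - z\<close> bounds the squared
  norm by the absolute sum of the multipliers times \<open>s\<close>. With the multiplier bound, one
  factor \<open>norm (y - z)\<close> cancels.\<close>

lemma stationary_norm_bound:
  fixes g :: "nat \<Rightarrow> 'a::real_inner"
  assumes rep: "y - z = (\<Sum>i\<in>K. d i *\<^sub>R g i)"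
    and M: "(\<Sum>i\<in>K. \<bar>d i\<bar>) \<le> M * norm (y - z)" "0 \<le> M" "0 \<le> s"
    and bnd: "\<And>i. i \<in> K \<Longrightarrow> d i * (g i \<bullet> (y - z)) \<le> \<bar>d i\<bar> * s"
  shows "norm (y - z) \<le> M * s"
proof (cases "y = z")
  case False
  have "(norm (y - z))\<^sup>2 = (\<Sum>i\<in>K. d i *\<^sub>R g i) \<bullet> (y - z)"
    unfolding rep[symmetric] by (rule power2_norm_eq_inner)
  also have "\<dots> \<le> (\<Sum>i\<in>K. \<bar>d i\<bar>) * s"
    unfolding inner_sum_left inner_scaleR_left sum_distrib_right by (intro sum_mono bnd)
  also have "\<dots> \<le> (M * norm (y - z)) * s"
    using M by (intro mult_right_mono) auto
  finally have "norm (y - z) * norm (y - z) \<le> norm (y - z) * (M * s)"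
    by (simp add: power2_eq_square mult_ac)
  then show ?thesis using False by simp
qed (use M in simp)

text \<open>On the segment from \<open>w\<close> to the limit point, feasibility coincides with membership in the
  open set \<open>{u. (xb, u) \<in> W}\<close>, so the feasible part of the segment is clopen.\<close>

lemma convex_constraints_closed_graph:
  fixes F :: "('a::t2_space \<Rightarrow> 'b::real_normed_vector \<Rightarrow> real) set"
  assumes W: "open W" "{xb} \<times> {u. \<forall>f\<in>F. f xb u \<le> 0} \<subseteq> W"
    and cont: "\<And>f. f \<in> F \<Longrightarrow> continuous_on W (\<lambda>(x, u). f x u)"
    and clo: "closed {u. \<forall>f\<in>F. f xb u \<le> 0}"
    and conv: "\<And>f n. f \<in> F \<Longrightarrow> convex_on UNIV (f (x n))"
    and w: "\<forall>f\<in>F. f xb w \<le> 0"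
    and lim: "x \<longlonglongrightarrow> xb" "v \<longlonglongrightarrow> vb"
    and feas: "\<And>f n. f \<in> F \<Longrightarrow> f (x n) (v n) \<le> 0"
  shows "\<forall>f\<in>F. f xb vb \<le> 0"
proof -
  let ?G = "{u. \<forall>f\<in>F. f xb u \<le> 0}"
  let ?O = "{u. (xb, u) \<in> W}"
  \<comment> \<open>The segment runs from the feasible \<open>w\<close> at 0 to the limit
    \<open>vb\<close> at 1.\<close>
  define u where "u t = (1 - t) *\<^sub>R w + t *\<^sub>R vb" for t
  have contu: "continuous_on UNIV u" unfolding u_def by (intro continuous_intros)
  have lc: "(\<lambda>n. f (x n) (q n)) \<longlonglongrightarrow> f xb q0" if "f \<in> F" "(xb, q0) \<in> W" "q \<longlonglongrightarrow> q0" for f q q0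
  proof -
    have "isCont (\<lambda>(x, u). f x u) (xb, q0)"
      using cont[OF that(1)] W(1) that(2) by (simp add: continuous_on_eq_continuous_at)
    moreover have "(\<lambda>n. (x n, q n)) \<longlonglongrightarrow> (xb, q0)"
      by (intro tendsto_Pair lim that)
    ultimately show ?thesis using isCont_tendsto_compose by fastforce
  qed
  \<comment> \<open>Convexity of \<open>f (x n)\<close> between \<open>w\<close> and the feasible
    \<open>v n\<close> bounds the value by \<open>(1 - t) * f (x n) w\<close>. The limit may be
    taken because \<open>(xb, u t)\<close> and \<open>(xb, w)\<close> both lie in \<open>W\<close>,
    where \<open>f\<close> is jointly continuous.\<close>
  have "u t \<in> ?G" if t: "t \<in> {0..1}" "u t \<in> ?O" for t
  proof safe
    fix f assume f: "f \<in> F"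
    have "(\<lambda>n. f (x n) ((1 - t) *\<^sub>R w + t *\<^sub>R v n)) \<longlonglongrightarrow> f xb (u t)"
      using t f by (intro lc) (auto simp: u_def intro!: tendsto_intros lim)
    moreover have "(\<lambda>n. (1 - t) * f (x n) w) \<longlonglongrightarrow> (1 - t) * f xb w"
      using W(2) w f by (intro tendsto_mult tendsto_const lc) auto
    moreover have "f (x n) ((1 - t) *\<^sub>R w + t *\<^sub>R v n) \<le> (1 - t) * f (x n) w" for n
    proof -
      have "f (x n) ((1 - t) *\<^sub>R w + t *\<^sub>R v n) \<le> (1 - t) * f (x n) w + t * f (x n) (v n)"
        using t by (intro convex_onD[OF conv[OF f]]) auto
      moreover have "t * f (x n) (v n) \<le> 0"
        using t feas[OF f] by (auto intro: mult_nonneg_nonpos)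
      ultimately show ?thesis by linarith
    qed
    ultimately have "f xb (u t) \<le> (1 - t) * f xb w"
      by (intro LIMSEQ_le) auto
    also have "\<dots> \<le> 0" using t w f by (auto intro: mult_nonneg_nonpos)
    finally show "f xb (u t) \<le> 0" .
  qed
  then have eq: "{0..1} \<inter> u -` ?G = {0..1} \<inter> u -` ?O"
    using W(2) by auto
  have "open ?O"
  proof -
    have "?O = Pair xb -` W" by auto
    also have "open \<dots>" by (intro open_vimage W continuous_intros)
    finally show ?thesis .
  qed
  then have "openin (top_of_set {0..1}) ({0..1} \<inter> u -` ?G)"
    unfolding eq by (intro openin_open_Int open_vimage contu)
  moreover have "closedin (top_of_set {0..1}) ({0..1} \<inter> u -` ?G)"
    by (intro closedin_closed_Int closed_vimage contu clo)
  moreover have "connected {0..1::real}" by simp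
  ultimately have "{0..1} \<inter> u -` ?G = {} \<or> {0..1} \<inter> u -` ?G = {0..1}"
    unfolding connected_clopen by blast
  moreover have "0 \<in> {0..1} \<inter> u -` ?G" using w by (auto simp: u_def)
  ultimately have "{0..1} \<inter> u -` ?G = {0..1}" by blast
  then have "1 \<in> {0..1} \<inter> u -` ?G" by simp
  then show ?thesis by (simp add: u_def)
qed

section \<open>Multiplier bounds under RCPLD\<close>

lemma spanning_subfamily:
  fixes g :: "nat \<Rightarrow> 'a::euclidean_space"
  assumes "S \<subseteq> J" "finite J" "\<not> fam_lin_dep g S" "dim (g ` J) \<le> card S"
  shows "g ` J \<subseteq> span (g ` S)"
proof -
  have "finite S" using assms finite_subset by blast
  note S = not_fam_lin_depD[OF assms(3) this]
  \<comment> \<open>The image of \<open>S\<close> has \<open>card S\<close> independent vectors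
    inside a family of dimension at most \<open>card S\<close>, so it spans that family.\<close>
  show ?thesis
    using S(2) assms by (intro card_ge_dim_independent) (auto simp: card_image[OF S(1)])
qed

text \<open>Constant rank reduces the equality multipliers to the basis \<open>S\<close>, Caratheodory reduces the
  inequalities to some \<open>K\<close> with \<open>K \<union> S\<close> independent at \<open>(x, y)\<close>; by condition (iii) such a \<open>K\<close> is
  positively independent at the base point, which gives a bound by compactness. There are only
  finitely many \<open>K\<close>.\<close>

lemma RCPLD_multiplier_bound:
  fixes h :: "nat \<Rightarrow> real^'n \<Rightarrow> real^'m \<Rightarrow> ereal"
  assumes lp: "l \<le> p" and rc: "RCPLD h l p \<Omega> x0 y0" and x0: "x0 \<in> \<Omega>"
    and cont: "\<And>i. i \<in> {1..p} \<Longrightarrow>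
      ((\<lambda>(x, y). ygrad h i x y) \<longlongrightarrow> ygrad h i x0 y0) (nhds (x0, y0))"
  shows "\<exists>M>0. \<forall>\<^sub>F (x, y) in nhds (x0, y0). x \<in> \<Omega> \<longrightarrow>
    (\<forall>A c. A \<subseteq> active h l x0 y0 \<longrightarrow> (\<forall>i\<in>A. 0 \<le> c i) \<longrightarrow>
      (\<exists>K\<subseteq>A. \<exists>d. (\<forall>i\<in>K. 0 \<le> d i) \<and>
        (\<Sum>i\<in>K \<union> {l+1..p}. d i *\<^sub>R ygrad h i x y) = (\<Sum>i\<in>A \<union> {l+1..p}. c i *\<^sub>R ygrad h i x y) \<and>
        (\<Sum>i\<in>K \<union> {l+1..p}. \<bar>d i\<bar>) \<le> M * norm (\<Sum>i\<in>A \<union> {l+1..p}. c i *\<^sub>R ygrad h i x y)))"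
proof -
  define J where "J = {l+1..p}"
  define act where "act = active h l x0 y0"
  define G where "G i z = ygrad h i (fst z) (snd z)" for i z
  define z0 where "z0 = (x0, y0)"
  have act: "act \<subseteq> {1..l}" "finite act"
    by (auto simp: act_def active_def)
  have fJ: "finite J" "act \<inter> J = {}" using act by (auto simp: J_def)
  obtain U S r where U: "open U" "z0 \<in> U" and S: "S \<subseteq> J"
    and indep0: "\<not> fam_lin_dep (\<lambda>i. G i z0) S"
    and span0: "span ((\<lambda>i. G i z0) ` S) = span ((\<lambda>i. G i z0) ` J)"
    and rank: "\<And>z. z \<in> U \<Longrightarrow> fst z \<in> \<Omega> \<Longrightarrow> dim ((\<lambda>i. G i z) ` J) = r"
    and iii: "\<And>K z. K \<subseteq> act \<Longrightarrow> pos_lin_dep (\<lambda>i. G i z0) K (\<lambda>i. G i z0) S \<Longrightarrow>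
       z \<in> U \<Longrightarrow> fst z \<in> \<Omega> \<Longrightarrow> fam_lin_dep (\<lambda>i. G i z) (K \<union> S)"
  proof -
    from rc obtain U S r where "open U" "(x0, y0) \<in> U" "S \<subseteq> {l+1..p}"
      "\<not> fam_lin_dep (\<lambda>i. ygrad h i x0 y0) S"
      "span ((\<lambda>i. ygrad h i x0 y0) ` S) = span ((\<lambda>i. ygrad h i x0 y0) ` {l+1..p})"
      "\<forall>x y. (x, y) \<in> U \<and> x \<in> \<Omega> \<longrightarrow> dim ((\<lambda>i. ygrad h i x y) ` {l+1..p}) = r"
      "\<forall>K. K \<subseteq> active h l x0 y0 \<longrightarrow>
         pos_lin_dep (\<lambda>i. ygrad h i x0 y0) K (\<lambda>i. ygrad h i x0 y0) S \<longrightarrow>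
         (\<forall>x y. (x, y) \<in> U \<and> x \<in> \<Omega> \<longrightarrow> fam_lin_dep (\<lambda>i. ygrad h i x y) (K \<union> S))"
      unfolding RCPLD_def by (elim exE conjE) (rule that)
    then show ?thesis
      by (intro that[of U S r]) (simp_all only: J_def act_def G_def z0_def fst_conv snd_conv surjective_pairing[symmetric] simp_thms)
  qed
  have fS: "finite S" "act \<inter> S = {}" using S fJ finite_subset by auto
  have contG: "(G i \<longlongrightarrow> G i z0) (nhds z0)" if "i \<in> act \<union> J" for i
  proof -
    have "i \<in> {1..p}" using that act lp by (auto simp: J_def)
    from cont[OF this] show ?thesis by (simp add: G_def[abs_def] z0_def case_prod_beta')
  qed
  \<comment> \<open>The constant rank is read off at the base point, where \<open>S\<close> indexes
    a basis.\<close>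
  have r: "r = card S"
  proof -
    have "r = dim ((\<lambda>i. G i z0) ` J)" using rank[OF U(2)] x0 by (simp add: z0_def)
    also have "\<dots> = dim ((\<lambda>i. G i z0) ` S)" using span0 by (metis dim_span)
    also have "\<dots> = card ((\<lambda>i. G i z0) ` S)"
      using not_fam_lin_depD(2)[OF indep0 fS(1)] by (rule dim_eq_card_independent)
    also have "\<dots> = card S" by (rule card_image[OF not_fam_lin_depD(1)[OF indep0 fS(1)]])
    finally show ?thesis .
  qed
  have fK: "finite K" "K \<inter> S = {}" if "K \<subseteq> act" for K
    using that act(2) fS finite_subset by auto
  let ?B = "\<lambda>M K z. \<forall>c::nat \<Rightarrow> real. (\<forall>i\<in>K. 0 \<le> c i) \<longrightarrow>
      (\<Sum>i\<in>K \<union> S. \<bar>c i\<bar>) \<le> M * norm (\<Sum>i\<in>K \<union> S. c i *\<^sub>R G i z)"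
  have ex: "\<exists>M>0. \<forall>\<^sub>F z in nhds z0. fst z \<in> \<Omega> \<longrightarrow> \<not> fam_lin_dep (\<lambda>i. G i z) (K \<union> S) \<longrightarrow> ?B M K z"
    if K: "K \<subseteq> act" for K
  proof (cases "pos_lin_dep (\<lambda>i. G i z0) K (\<lambda>i. G i z0) S")
    case True
    \<comment> \<open>Condition (iii) makes \<open>K \<union> S\<close> dependent at all nearby
      points over \<Omega>, so the bound holds vacuously and the constant 1 is arbitrary.\<close>
    have "\<forall>\<^sub>F z in nhds z0. z \<in> U" using U by (rule eventually_nhds_in_open)
    then have "\<forall>\<^sub>F z in nhds z0. fst z \<in> \<Omega> \<longrightarrow> \<not> fam_lin_dep (\<lambda>i. G i z) (K \<union> S) \<longrightarrow> ?B 1 K z"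
      by (rule eventually_mono) (intro impI, elim notE, rule iii[OF K True])
    then show ?thesis by (intro exI[of _ 1] conjI zero_less_one)
  next
    case False
    have "\<exists>M>0. \<forall>\<^sub>F z in nhds z0. ?B M K z"
      by (rule pos_lin_indep_bound_eventually[of _ _ G z0, OF fK(1)[OF K] fS(1) fK(2)[OF K] False])
         (rule contG, use K S in blast)
    then obtain M where M: "M > 0" "\<forall>\<^sub>F z in nhds z0. ?B M K z" by (elim exE conjE)
    from M(2) have "\<forall>\<^sub>F z in nhds z0. fst z \<in> \<Omega> \<longrightarrow> \<not> fam_lin_dep (\<lambda>i. G i z) (K \<union> S) \<longrightarrow> ?B M K z"
      by (rule eventually_mono) (intro impI)
    with M(1) show ?thesis by (intro exI[of _ M] conjI)
  qed
  have "\<forall>K\<in>Pow act. \<exists>M>0. \<forall>\<^sub>F z in nhds z0. fst z \<in> \<Omega> \<longrightarrow>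
      \<not> fam_lin_dep (\<lambda>i. G i z) (K \<union> S) \<longrightarrow> ?B M K z"
    by (intro ballI ex PowD)
  from bchoice[OF this] obtain MM where MM0: "\<forall>K\<in>Pow act. MM K > 0 \<and> (\<forall>\<^sub>F z in nhds z0.
      fst z \<in> \<Omega> \<longrightarrow> \<not> fam_lin_dep (\<lambda>i. G i z) (K \<union> S) \<longrightarrow> ?B (MM K) K z)"
    by (elim exE)
  note MM = MM0[THEN bspec, THEN conjunct1] MM0[THEN bspec, THEN conjunct2]
  have fPow: "finite (Pow act)" using act by simp
  \<comment> \<open>A sum of finitely many positive constants dominates each of them.\<close>
  define M where "M = (\<Sum>K\<in>Pow act. MM K)"
  have M_ge: "MM K \<le> M" if "K \<in> Pow act" for K
    unfolding M_def using that fPow MM(1) by (intro member_le_sum) (auto intro: less_imp_le)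
  have "M > 0" using M_ge[of "{}"] MM(1)[of "{}"] by simp
  \<comment> \<open>Independence of \<open>S\<close> persists near \<open>z0\<close>: it is positive
    independence with no sign-restricted part, and the uniform bound with \<open>K = {}\<close>
    forces the coefficients of a vanishing combination to be 0.\<close>
  have evS: "\<forall>\<^sub>F z in nhds z0. \<not> fam_lin_dep (\<lambda>i. G i z) S"
  proof -
    have "\<not> pos_lin_dep (\<lambda>i. G i z0) {} (\<lambda>i. G i z0) S"
      using indep0 by (simp add: pos_lin_dep_def fam_lin_dep_def)
    then have "\<exists>M>0. \<forall>\<^sub>F z in nhds z0. ?B M {} z"
      by (rule pos_lin_indep_bound_eventually[of _ _ G z0, OF finite.emptyI fS(1) Int_empty_left])
         (use S contG in blast)
    then obtain M where "\<forall>\<^sub>F z in nhds z0. ?B M {} z" by (elim exE conjE)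
    then show ?thesis
    proof (rule eventually_mono, intro notI)
      fix z assume B: "?B M {} z" and "fam_lin_dep (\<lambda>i. G i z) S"
      then obtain c where c: "\<exists>i\<in>S. c i \<noteq> 0" "(\<Sum>i\<in>S. c i *\<^sub>R G i z) = 0"
        unfolding fam_lin_dep_def by blast
      have "(\<Sum>i\<in>S. \<bar>c i\<bar>) \<le> 0" using B[rule_format, of c] c(2) by simp
      then have "(\<Sum>i\<in>S. \<bar>c i\<bar>) = 0" by (intro antisym sum_nonneg) auto
      then show False using c(1) fS(1) by (simp add: sum_nonneg_eq_0_iff)
    qed
  qed
  have "\<forall>\<^sub>F z in nhds z0. z \<in> U" using U by (rule eventually_nhds_in_open)
  moreover have "\<forall>\<^sub>F z in nhds z0. \<forall>K\<in>Pow act. fst z \<in> \<Omega> \<longrightarrow>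
      \<not> fam_lin_dep (\<lambda>i. G i z) (K \<union> S) \<longrightarrow> ?B (MM K) K z"
    by (rule eventually_ball_finite[OF fPow]) (rule ballI, rule MM(2))
  ultimately have "\<forall>\<^sub>F z in nhds z0. fst z \<in> \<Omega> \<longrightarrow>
    (\<forall>A c. A \<subseteq> act \<longrightarrow> (\<forall>i\<in>A. 0 \<le> c i) \<longrightarrow>
      (\<exists>K\<subseteq>A. \<exists>d. (\<forall>i\<in>K. 0 \<le> d i) \<and>
        (\<Sum>i\<in>K \<union> J. d i *\<^sub>R G i z) = (\<Sum>i\<in>A \<union> J. c i *\<^sub>R G i z) \<and>
        (\<Sum>i\<in>K \<union> J. \<bar>d i\<bar>) \<le> M * norm (\<Sum>i\<in>A \<union> J. c i *\<^sub>R G i z)))"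
    using evS
  proof (eventually_elim, intro impI allI)
    fix z A and c :: "nat \<Rightarrow> real"
    assume zU: "z \<in> U" and B: "\<forall>K\<in>Pow act. fst z \<in> \<Omega> \<longrightarrow>
        \<not> fam_lin_dep (\<lambda>i. G i z) (K \<union> S) \<longrightarrow> ?B (MM K) K z"
      and indep: "\<not> fam_lin_dep (\<lambda>i. G i z) S" and z\<Omega>: "fst z \<in> \<Omega>"
      and A: "A \<subseteq> act" and c: "\<forall>i\<in>A. 0 \<le> c i"
    let ?w = "\<Sum>i\<in>A \<union> J. c i *\<^sub>R G i z"
    have AJ: "A \<inter> J = {}" "A \<inter> S = {}" using A fJ fS by auto
    \<comment> \<open>At \<open>z\<close> the rank over \<open>J\<close> is still
      \<open>card S\<close> and \<open>S\<close> is still independent, so \<open>S\<close> spans all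
      equality gradients and their combination can be rewritten over \<open>S\<close>.\<close>
    have "(\<lambda>i. G i z) ` J \<subseteq> span ((\<lambda>i. G i z) ` S)"
      by (rule spanning_subfamily[OF S fJ(1) indep]) (simp only: rank[OF zU z\<Omega>] r)
    then have "(\<Sum>i\<in>J. c i *\<^sub>R G i z) \<in> span ((\<lambda>i. G i z) ` S)"
      by (intro span_sum span_scale) auto
    then obtain b where b: "(\<Sum>i\<in>J. c i *\<^sub>R G i z) = (\<Sum>i\<in>S. b i *\<^sub>R G i z)"
      using span_image_combination[OF fS(1)] by blast
    define c' where "c' i = (if i \<in> A then c i else b i)" for i
    have "(\<Sum>i\<in>A \<union> S. c' i *\<^sub>R G i z) = (\<Sum>i\<in>A. c' i *\<^sub>R G i z) + (\<Sum>i\<in>S. c' i *\<^sub>R G i z)"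
      by (rule sum.union_disjoint[OF fK(1)[OF A] fS(1) AJ(2)])
    also have "(\<Sum>i\<in>A. c' i *\<^sub>R G i z) = (\<Sum>i\<in>A. c i *\<^sub>R G i z)"
      by (intro sum.cong) (auto simp: c'_def)
    also have "(\<Sum>i\<in>S. c' i *\<^sub>R G i z) = (\<Sum>i\<in>S. b i *\<^sub>R G i z)"
      using AJ(2) by (intro sum.cong) (auto simp: c'_def)
    also note b[symmetric]
    also note sum.union_disjoint[OF fK(1)[OF A] fJ(1) AJ(1), symmetric]
    finally have c'_eq: "(\<Sum>i\<in>A \<union> S. c' i *\<^sub>R G i z) = ?w" .
    have "\<forall>i\<in>A. 0 \<le> c' i" using c by (simp add: c'_def)
    from conic_caratheodory[OF fK(1)[OF A] fS(1) AJ(2) indep this]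
    obtain K d where K: "K \<subseteq> A" "\<not> fam_lin_dep (\<lambda>i. G i z) (K \<union> S)" "\<forall>i\<in>K. 0 \<le> d i"
      and d: "(\<Sum>i\<in>K \<union> S. d i *\<^sub>R G i z) = ?w"
      unfolding c'_eq by blast
    have KP: "K \<in> Pow act" using K A by auto
    have "(\<Sum>i\<in>K \<union> S. \<bar>d i\<bar>) \<le> MM K * norm ?w"
      using B[rule_format, OF KP z\<Omega> K(2), of d] K(3) unfolding d by blast
    also have "\<dots> \<le> M * norm ?w" by (intro mult_right_mono M_ge KP norm_ge_zero)
    finally have d_le: "(\<Sum>i\<in>K \<union> S. \<bar>d i\<bar>) \<le> M * norm ?w" .
    \<comment> \<open>Extension by zero returns from the basis \<open>S\<close> to the full set
      \<open>J\<close> without changing the vector or the absolute sum.\<close>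
    define d' where "d' i = (if i \<in> K \<union> S then d i else 0)" for i
    have fKJ: "finite (K \<union> J)" using KP act(2) fJ finite_subset by auto
    have "(\<Sum>i\<in>K \<union> J. d' i *\<^sub>R G i z) = (\<Sum>i\<in>K \<union> S. d i *\<^sub>R G i z)"
      using S by (intro sum.mono_neutral_cong_right fKJ) (auto simp: d'_def)
    moreover have "(\<Sum>i\<in>K \<union> J. \<bar>d' i\<bar>) = (\<Sum>i\<in>K \<union> S. \<bar>d i\<bar>)"
      using S by (intro sum.mono_neutral_cong_right fKJ) (auto simp: d'_def)
    moreover have "\<forall>i\<in>K. 0 \<le> d' i" using K(3) by (simp add: d'_def)
    ultimately show "\<exists>K\<subseteq>A. \<exists>d. (\<forall>i\<in>K. 0 \<le> d i) \<and> (\<Sum>i\<in>K \<union> J. d i *\<^sub>R G i z) = ?w \<and>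
        (\<Sum>i\<in>K \<union> J. \<bar>d i\<bar>) \<le> M * norm ?w"
      using K(1) d d_le by (intro exI[of _ K] conjI exI[of _ d']) (simp_all only:)
  qed
  with \<open>M > 0\<close> show ?thesis
    unfolding J_def act_def G_def z0_def case_prod_beta' by (intro exI[of _ M] conjI)
qed

text \<open>The gradient inequality bounds each inner product of a gradient with
  \<open>y - z n\<close>: from above for a violated inequality, and in absolute value for an
  equality, which is both convex and concave. The norm bound for stationary points then applies at
  \<open>z n\<close>, and the limit gives the estimate at \<open>v\<close>.\<close>

lemma dist_le_residual_of_multiplier_bound:
  fixes f :: "nat \<Rightarrow> 'a::euclidean_space \<Rightarrow> real"
  assumes fin: "finite J"
    and conv: "\<And>i. i \<in> I \<union> J \<Longrightarrow> convex_on UNIV (f i)" "\<And>i. i \<in> J \<Longrightarrow> convex_on UNIV (\<lambda>u. - f i u)"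
    and cont: "\<And>i. i \<in> J \<Longrightarrow> continuous_on UNIV (f i)"
    and lim: "z \<longlonglongrightarrow> v" and v: "\<And>i. i \<in> J \<Longrightarrow> f i v = 0"
    and r: "0 \<le> r" "\<And>i. i \<in> I \<Longrightarrow> f i y \<le> r" "\<And>i. i \<in> J \<Longrightarrow> \<bar>f i y\<bar> \<le> r"
    and "0 \<le> M"
    and ev: "\<forall>\<^sub>F n in sequentially. \<exists>K\<subseteq>I. \<exists>d g.
      (\<forall>i\<in>K \<union> J. (f i has_derivative (\<lambda>u. g i \<bullet> u)) (at (z n))) \<and>
      (\<forall>i\<in>K. 0 \<le> d i \<and> 0 < f i (z n)) \<and> y - z n = (\<Sum>i\<in>K \<union> J. d i *\<^sub>R g i) \<and>
      (\<Sum>i\<in>K \<union> J. \<bar>d i\<bar>) \<le> M * norm (y - z n)"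
  shows "norm (y - v) \<le> M * r"
proof -
  \<comment> \<open>The points \<open>z n\<close> may violate the equalities. This error enters the
    bound and tends to 0 because \<open>v\<close> satisfies them.\<close>
  define \<eta> where "\<eta> n = (\<Sum>i\<in>J. \<bar>f i (z n)\<bar>)" for n
  have \<eta>0: "0 \<le> \<eta> n" for n by (simp add: \<eta>_def sum_nonneg)
  have \<eta>_ge: "\<bar>f i (z n)\<bar> \<le> \<eta> n" if "i \<in> J" for i n
    unfolding \<eta>_def using that fin by (intro member_le_sum) auto
  have bound: "\<forall>\<^sub>F n in sequentially. norm (y - z n) \<le> M * (r + \<eta> n)"
    using ev
  proof (rule eventually_mono)
    fix n assume "\<exists>K\<subseteq>I. \<exists>d g.
      (\<forall>i\<in>K \<union> J. (f i has_derivative (\<lambda>u. g i \<bullet> u)) (at (z n))) \<and>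
      (\<forall>i\<in>K. 0 \<le> d i \<and> 0 < f i (z n)) \<and> y - z n = (\<Sum>i\<in>K \<union> J. d i *\<^sub>R g i) \<and>
      (\<Sum>i\<in>K \<union> J. \<bar>d i\<bar>) \<le> M * norm (y - z n)"
    then obtain K d g where K: "K \<subseteq> I"
      and g: "\<forall>i\<in>K \<union> J. (f i has_derivative (\<lambda>u. g i \<bullet> u)) (at (z n))"
      and d: "\<forall>i\<in>K. 0 \<le> d i \<and> 0 < f i (z n)" "y - z n = (\<Sum>i\<in>K \<union> J. d i *\<^sub>R g i)"
        "(\<Sum>i\<in>K \<union> J. \<bar>d i\<bar>) \<le> M * norm (y - z n)" by (elim exE conjE)
    show "norm (y - z n) \<le> M * (r + \<eta> n)"
    proof (rule stationary_norm_bound[OF d(2,3) \<open>0 \<le> M\<close>])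
      show "0 \<le> r + \<eta> n" using r(1) \<eta>0[of n] by simp
    next
      fix i assume i: "i \<in> K \<union> J"
      let ?q = "g i \<bullet> (y - z n)"
      have gi: "(f i has_derivative (\<lambda>u. g i \<bullet> u)) (at (z n))" using g i by (rule bspec)
      have up: "?q \<le> f i y - f i (z n)"
        using convex_gradient_inequality[OF conv(1) gi, of y] i K by (auto simp: algebra_simps)
      show "d i * ?q \<le> \<bar>d i\<bar> * (r + \<eta> n)"
      proof (cases "i \<in> J")
        case True
        have "((\<lambda>u. - f i u) has_derivative (\<lambda>u. (- g i) \<bullet> u)) (at (z n))"
          using has_derivative_minus[OF gi] by simp
        from convex_gradient_inequality[OF conv(2)[OF True] this, of y]
        have "- ?q \<le> - f i y + f i (z n)" by simp
        with up have "\<bar>?q\<bar> \<le> r + \<eta> n"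
          using r(3)[OF True] \<eta>_ge[OF True, of n] by linarith
        then have "\<bar>d i * ?q\<bar> \<le> \<bar>d i\<bar> * (r + \<eta> n)"
          by (simp only: abs_mult mult_left_mono abs_ge_zero)
        then show ?thesis by linarith
      next
        case False
        with i have iK: "i \<in> K" by simp
        then have "?q \<le> r + \<eta> n" "0 \<le> d i"
          using up d(1) r(2)[of i] K \<eta>0[of n] by force+
        then show ?thesis by (simp add: mult_left_mono)
      qed
    qed
  qed
  have "(\<lambda>n. M * (r + \<eta> n)) \<longlonglongrightarrow> M * (r + (\<Sum>i\<in>J. \<bar>f i v\<bar>))"
    unfolding \<eta>_def
    by (intro tendsto_intros continuous_on_tendsto_compose[OF cont lim]) auto
  moreover have "(\<Sum>i\<in>J. \<bar>f i v\<bar>) = 0" using v by simp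
  ultimately have lim2: "(\<lambda>n. M * (r + \<eta> n)) \<longlonglongrightarrow> M * r" by simp
  have "(\<lambda>n. norm (y - z n)) \<longlonglongrightarrow> norm (y - v)" by (intro tendsto_intros lim)
  from tendsto_le[OF _ lim2 this bound] show ?thesis by simp
qed

section \<open>Gradients and real-valued versions of the constraints\<close>

lemma ygrad_has_derivative:
  assumes "(\<lambda>v. real_of_ereal (h i x v)) differentiable (at y)"
  shows "((\<lambda>v. real_of_ereal (h i x v)) has_derivative (\<lambda>v. ygrad h i x y \<bullet> v)) (at y)"
proof -
  obtain D where D: "((\<lambda>v. real_of_ereal (h i x v)) has_derivative D) (at y)"
    using assms unfolding differentiable_def by blast
  \<comment> \<open>The adjoint applied to 1 represents the derivative by an inner product, so the
    choice in \<open>ygrad\<close> has a witness.\<close>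
  have "D v = adjoint D 1 \<bullet> v" for v
    using adjoint_works[OF has_derivative_linear[OF D], of v 1] by (simp add: inner_commute)
  then have "D = (\<lambda>v. adjoint D 1 \<bullet> v)" by (rule ext)
  with D have "\<exists>g. ((\<lambda>v. real_of_ereal (h i x v)) has_derivative (\<lambda>v. g \<bullet> v)) (at y)"
    by metis
  then show ?thesis unfolding ygrad_def by (rule someI_ex)
qed

text \<open>For a finite-valued function, the set in \<open>ereal_convex\<close> is the epigraph of
  its real version.\<close>

lemma ereal_convex_imp_convex_on:
  assumes "ereal_convex f" "\<And>y. \<bar>f y\<bar> \<noteq> \<infinity>"
  shows "convex_on UNIV (\<lambda>y. real_of_ereal (f y))"
proof -
  have "f y \<le> ereal t \<longleftrightarrow> real_of_ereal (f y) \<le> t" for y t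
    using assms(2)[of y] by (cases "f y") auto
  then have "epigraph UNIV (\<lambda>y. real_of_ereal (f y)) = {(y, t). f y \<le> ereal t}"
    by (auto simp: epigraph_def)
  with assms(1) show ?thesis
    unfolding ereal_convex_def convex_epigraph_convex by simp
qed

lemma ereal_affine_imp_convex_on:
  assumes "ereal_affine f"
  shows "convex_on UNIV (\<lambda>y. real_of_ereal (f y))" "convex_on UNIV (\<lambda>y. - real_of_ereal (f y))"
proof -
  obtain a b where "\<And>y. f y = ereal (a \<bullet> y + b)"
    using assms unfolding ereal_affine_def by blast
  then show "convex_on UNIV (\<lambda>y. real_of_ereal (f y))" "convex_on UNIV (\<lambda>y. - real_of_ereal (f y))"
    by (auto intro!: convex_onI simp: inner_add_right algebra_simps)
qed

lemma residual_bounds: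
  shows "0 \<le> residual h l p x y"
    and "i \<in> {1..l} \<Longrightarrow> h i x y \<le> residual h l p x y"
    and "i \<in> {l+1..p} \<Longrightarrow> \<bar>h i x y\<bar> \<le> residual h l p x y"
  unfolding residual_def by (rule Sup_upper; blast)+

theorem theorem3p3:
  fixes h :: "nat \<Rightarrow> real^'n \<Rightarrow> real^'m \<Rightarrow> ereal"
    and l p :: nat and xb :: "real^'n"
  assumes lp: "l \<le> p"
    and xdom: "xb \<in> domG h l p"
    and smooth: "\<exists>W. open W \<and> {xb} \<times> Gam h l p xb \<subseteq> W \<and>
        (\<forall>i\<in>{1..p}.
           (\<forall>x y. (x, y) \<in> W \<longrightarrow> \<bar>h i x y\<bar> \<noteq> \<infinity> \<and>
               (\<lambda>v. real_of_ereal (h i x v)) differentiable (at y)) \<and>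
           continuous_on W (\<lambda>(x, y). h i x y) \<and>
           continuous_on W (\<lambda>(x, y). ygrad h i x y))"
    and cont_y: "\<forall>x\<in>domG h l p. \<forall>i\<in>{1..p}.
        (\<forall>y. \<bar>h i x y\<bar> \<noteq> \<infinity>) \<and> continuous_on UNIV (\<lambda>y. real_of_ereal (h i x y))"
    and A1: "\<forall>x. (\<forall>i\<in>{1..l}. ereal_convex (h i x)) \<and> (\<forall>i\<in>{l+1..p}. ereal_affine (h i x))"
    and A2: "locally_bounded_at (Gam h l p) xb"
    and rcpld: "\<forall>yb\<in>Gam h l p xb. RCPLD h l p (domG h l p) xb yb"
  shows "\<forall>yb\<in>Gam h l p xb. R_regular h l p (domG h l p) xb yb"
proof
  fix yb assume yb: "yb \<in> Gam h l p xb"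

  \<comment> \<open>Passage to real-valued constraint functions\<close>
  define I J where "I = {1..l}" and "J = {l+1..p}"
  define H where "H i x y = real_of_ereal (h i x y)" for i x y
  have IJ: "I \<union> J = {1..p}" using lp by (auto simp: I_def J_def)
  have fin: "finite I" "finite J" "I \<inter> J = {}" by (auto simp: I_def J_def)
  have hH: "h i x y = ereal (H i x y)" if "x \<in> domG h l p" "i \<in> I \<union> J" for i x y
    using cont_y that unfolding H_def IJ by (metis ereal_real)
  have Gam_eq: "Gam h l p x = {y. (\<forall>i\<in>I. H i x y \<le> 0) \<and> (\<forall>i\<in>J. H i x y = 0)}"
    if "x \<in> domG h l p" for x
    unfolding Gam_def I_def[symmetric] J_def[symmetric]
    using hH[OF that] by (simp add: zero_ereal_def)
  have contH: "continuous_on UNIV (H i x)" if "x \<in> domG h l p" "i \<in> I \<union> J" for i x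
    using cont_y that unfolding H_def[abs_def] IJ by blast
  have convH: "convex_on UNIV (H i x)" if "x \<in> domG h l p" "i \<in> I \<union> J" for i x
  proof (cases "i \<in> I")
    case True
    have "\<bar>h i x y\<bar> \<noteq> \<infinity>" for y using hH[OF that] by simp
    then show ?thesis
      using A1 True unfolding H_def[abs_def] I_def by (intro ereal_convex_imp_convex_on) auto
  next
    case False
    then show ?thesis
      using A1 that unfolding H_def[abs_def] J_def by (intro ereal_affine_imp_convex_on) auto
  qed
  have concH: "convex_on UNIV (\<lambda>y. - H i x y)" if "i \<in> J" for i x
    using A1 that unfolding H_def[abs_def] J_def by (intro ereal_affine_imp_convex_on) auto
  obtain W where W: "open W" "{xb} \<times> Gam h l p xb \<subseteq> W"
    and Wfin: "\<And>i x y. i \<in> I \<union> J \<Longrightarrow> (x, y) \<in> W \<Longrightarrow> \<bar>h i x y\<bar> \<noteq> \<infinity> \<and> H i x differentiable (at y)"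
    and Wcont: "\<And>i. i \<in> I \<union> J \<Longrightarrow> continuous_on W (\<lambda>(x, y). h i x y)"
    and Wgrad: "\<And>i. i \<in> I \<union> J \<Longrightarrow> continuous_on W (\<lambda>(x, y). ygrad h i x y)"
  proof -
    obtain W where W: "open W" "{xb} \<times> Gam h l p xb \<subseteq> W" "\<forall>i\<in>I \<union> J.
        (\<forall>x y. (x, y) \<in> W \<longrightarrow> \<bar>h i x y\<bar> \<noteq> \<infinity> \<and> H i x differentiable (at y)) \<and>
        continuous_on W (\<lambda>(x, y). h i x y) \<and> continuous_on W (\<lambda>(x, y). ygrad h i x y)"
      using smooth unfolding IJ[symmetric] H_def[abs_def] by (elim exE conjE)
    note W3 = bspec[OF W(3)]
    show ?thesis
    proof (rule that[OF W(1,2)])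
      show "\<bar>h i x y\<bar> \<noteq> \<infinity> \<and> H i x differentiable (at y)" if "i \<in> I \<union> J" "(x, y) \<in> W" for i x y
        by (rule W3[OF that(1), THEN conjunct1, THEN spec, THEN spec, THEN mp, OF that(2)])
    qed (rule W3[THEN conjunct2, THEN conjunct1] W3[THEN conjunct2, THEN conjunct2], assumption)+
  qed
  have WcontH: "continuous_on W (\<lambda>(x, y). H i x y)" if i: "i \<in> I \<union> J" for i
  proof -
    have "continuous_on W (real_of_ereal \<circ> (\<lambda>(x, y). h i x y))"
      using continuous_on_iff_real[of W "\<lambda>(x, y). h i x y"] Wcont[OF i] Wfin[OF i] by auto
    then show ?thesis by (simp add: H_def o_def case_prod_beta')
  qed
  obtain B V where BV: "bounded B" "open V" "xb \<in> V" "\<And>x. x \<in> V \<Longrightarrow> Gam h l p x \<subseteq> B"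
    using A2 unfolding locally_bounded_at_def by blast
  show "R_regular h l p (domG h l p) xb yb"
  proof (rule ccontr)
    assume neg: "\<not> R_regular h l p (domG h l p) xb yb"
    \<comment> \<open>The neighbourhoods tested shrink in \<open>x\<close> only and are full in
      \<open>y\<close>, so the points \<open>y n\<close> need not stay near \<open>yb\<close> or be
      bounded. Intersecting with \<open>V\<close> keeps every \<open>Gam h l p (x n)\<close> inside
      \<open>B\<close>.\<close>
    have "\<exists>x y. x \<in> domG h l p \<and> x \<in> ball xb (1 / real (Suc n)) \<inter> V \<and>
      \<not> ereal (infdist y (Gam h l p x)) \<le> ereal (real (Suc n)) * residual h l p x y" for n
    proof (rule ccontr)
      assume no: "\<not> ?thesis"
      let ?U = "(ball xb (1 / real (Suc n)) \<inter> V) \<times> UNIV"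
      have "open ?U" using BV by (intro open_Times) auto
      moreover have "(xb, yb) \<in> ?U" using BV by simp
      moreover have "\<forall>x y. (x, y) \<in> ?U \<and> x \<in> domG h l p \<longrightarrow>
        ereal (infdist y (Gam h l p x)) \<le> ereal (real (Suc n)) * residual h l p x y"
        using no by blast
      moreover have "0 < real (Suc n)" by simp
      ultimately have "R_regular h l p (domG h l p) xb yb"
        unfolding R_regular_def by blast
      with neg show False by simp
    qed
    then obtain x y where xdomn: "\<And>n. x n \<in> domG h l p"
      and xball: "\<And>n. x n \<in> ball xb (1 / real (Suc n)) \<inter> V"
      and bad: "\<And>n. \<not> ereal (infdist (y n) (Gam h l p (x n)))
        \<le> ereal (real (Suc n)) * residual h l p (x n) (y n)"
      by metis
    have xlim: "x \<longlonglongrightarrow> xb"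
    proof (rule metric_tendsto_imp_tendsto[OF LIMSEQ_inverse_real_of_nat])
      show "\<forall>\<^sub>F n in sequentially. dist (x n) xb \<le> dist (inverse (real (Suc n))) 0"
        using xball by (intro always_eventually) (auto simp: dist_commute field_simps less_imp_le)
    qed
    \<comment> \<open>An infinite residual would make the violated estimate true, since its factor
      is positive.\<close>
    have "\<exists>r\<ge>0. residual h l p (x n) (y n) = ereal r" for n
    proof (cases "residual h l p (x n) (y n)")
      case PInf
      with bad[of n] show ?thesis by simp
    qed (use residual_bounds(1)[of h l p "x n" "y n"] in auto)
    then obtain r where r: "\<And>n. 0 \<le> r n" "\<And>n. residual h l p (x n) (y n) = ereal (r n)"
      by metis
    have bad': "real (Suc n) * r n < infdist (y n) (Gam h l p (x n))" for n
      using bad[of n] unfolding r(2) by simp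
    have "\<exists>v z. v \<in> Gam h l p (x n) \<and> z \<longlonglongrightarrow> v \<and>
      (\<forall>k g. (\<forall>i\<in>I \<union> J. (H i (x n) has_derivative (\<lambda>u. g i \<bullet> u)) (at (z k))) \<longrightarrow>
        (\<exists>A\<subseteq>I. \<exists>c. (\<forall>i\<in>A. 0 \<le> c i \<and> 0 < H i (x n) (z k)) \<and>
          y n - z k = (\<Sum>i\<in>A \<union> J. c i *\<^sub>R g i)))" for n
    proof -
      obtain v0 where "v0 \<in> Gam h l p (x n)" using xdomn[of n] by (auto simp: domG_def)
      then have "\<forall>i\<in>I. H i (x n) v0 \<le> 0" "\<forall>i\<in>J. H i (x n) v0 = 0"
        unfolding Gam_eq[OF xdomn] by auto
      from penalty_stationary_sequence[OF fin contH[OF xdomn] this, of "y n"]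
      show ?thesis unfolding Gam_eq[OF xdomn] mem_Collect_eq conj_assoc .
    qed
    then have "\<forall>n. \<exists>v z. v \<in> Gam h l p (x n) \<and> z \<longlonglongrightarrow> v \<and>
      (\<forall>k g. (\<forall>i\<in>I \<union> J. (H i (x n) has_derivative (\<lambda>u. g i \<bullet> u)) (at (z k))) \<longrightarrow>
        (\<exists>A\<subseteq>I. \<exists>c. (\<forall>i\<in>A. 0 \<le> c i \<and> 0 < H i (x n) (z k)) \<and>
          y n - z k = (\<Sum>i\<in>A \<union> J. c i *\<^sub>R g i)))"
      by (rule allI)
    from choice[OF this] obtain v where
      "\<forall>n. \<exists>z. v n \<in> Gam h l p (x n) \<and> z \<longlonglongrightarrow> v n \<and>
      (\<forall>k g. (\<forall>i\<in>I \<union> J. (H i (x n) has_derivative (\<lambda>u. g i \<bullet> u)) (at (z k))) \<longrightarrow>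
        (\<exists>A\<subseteq>I. \<exists>c. (\<forall>i\<in>A. 0 \<le> c i \<and> 0 < H i (x n) (z k)) \<and>
          y n - z k = (\<Sum>i\<in>A \<union> J. c i *\<^sub>R g i)))"
      by (elim exE)
    from choice[OF this] obtain z where vz:
      "\<forall>n. v n \<in> Gam h l p (x n) \<and> z n \<longlonglongrightarrow> v n \<and>
      (\<forall>k g. (\<forall>i\<in>I \<union> J. (H i (x n) has_derivative (\<lambda>u. g i \<bullet> u)) (at (z n k))) \<longrightarrow>
        (\<exists>A\<subseteq>I. \<exists>c. (\<forall>i\<in>A. 0 \<le> c i \<and> 0 < H i (x n) (z n k)) \<and>
          y n - z n k = (\<Sum>i\<in>A \<union> J. c i *\<^sub>R g i)))"
      by (elim exE)
    note v = vz[THEN spec, THEN conjunct1]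
      and z = vz[THEN spec, THEN conjunct2, THEN conjunct1]
      and stat = vz[THEN spec, THEN conjunct2, THEN conjunct2, THEN spec, THEN spec, THEN mp]

    \<comment> \<open>A cluster point of the feasible points\<close>
    have "bounded (range v)"
      using v xball BV(4) by (intro bounded_subset[OF BV(1)]) blast
    then obtain vb s where s: "strict_mono s" "(v \<circ> s) \<longlonglongrightarrow> vb"
      using bounded_imp_convergent_subsequence by blast
    have xs: "(x \<circ> s) \<longlonglongrightarrow> xb" by (rule LIMSEQ_subseq_LIMSEQ[OF xlim s(1)])
    \<comment> \<open>Joint continuity is known only on \<open>W\<close>, and
      \<open>(xb, vb)\<close> is not known to lie in \<open>W\<close> before \<open>vb\<close> is
      feasible. Hence the connectedness argument on the segment from \<open>yb\<close> to
      \<open>vb\<close>.\<close>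
    have vb: "vb \<in> Gam h l p xb"
    proof -
      \<comment> \<open>Each equality is split into two inequalities, both convex because the
        function is affine.\<close>
      define F where "F = H ` (I \<union> J) \<union> (\<lambda>i x u. - H i x u) ` J"
      have G: "Gam h l p x = {u. \<forall>f\<in>F. f x u \<le> 0}" if "x \<in> domG h l p" for x
        unfolding Gam_eq[OF that]
      proof (rule Collect_cong)
        fix u
        have "(\<forall>f\<in>F. f x u \<le> 0) \<longleftrightarrow>
            (\<forall>i\<in>I. H i x u \<le> 0) \<and> (\<forall>i\<in>J. H i x u \<le> 0) \<and> (\<forall>i\<in>J. - H i x u \<le> 0)"
          unfolding F_def ball_Un image_Un ball_simps by (simp only: conj_assoc)
        moreover have "(\<forall>i\<in>J. H i x u = 0) \<longleftrightarrow> (\<forall>i\<in>J. H i x u \<le> 0) \<and> (\<forall>i\<in>J. - H i x u \<le> 0)"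
          by (auto simp: order_eq_iff)
        ultimately show "(\<forall>i\<in>I. H i x u \<le> 0) \<and> (\<forall>i\<in>J. H i x u = 0) \<longleftrightarrow> (\<forall>f\<in>F. f x u \<le> 0)"
          by (simp only:)
      qed
      have "\<forall>f\<in>F. f xb vb \<le> 0"
      proof (rule convex_constraints_closed_graph[where W = W and xb = xb and x = "x \<circ> s" and v = "v \<circ> s"])
        show "{xb} \<times> {u. \<forall>f\<in>F. f xb u \<le> 0} \<subseteq> W" using W(2) G[OF xdom] by simp
        show "continuous_on W (\<lambda>(x, u). f x u)" if "f \<in> F" for f
          using that WcontH unfolding F_def
          by (auto simp: case_prod_beta' intro!: continuous_on_minus)
        show "closed {u. \<forall>f\<in>F. f xb u \<le> 0}"
        proof -
          have "continuous_on UNIV (f xb)" if "f \<in> F" for f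
            using that contH[OF xdom] by (auto simp: F_def intro!: continuous_on_minus)
          then have "closed (\<Inter>f\<in>F. {u. f xb u \<le> 0})"
            by (intro closed_INT ballI closed_Collect_le continuous_on_const)
          then show ?thesis by (simp add: INTER_eq)
        qed
        show "convex_on UNIV (f ((x \<circ> s) n))" if "f \<in> F" for f n
          using that convH concH xdomn by (auto simp: F_def)
        show "\<forall>f\<in>F. f xb yb \<le> 0" using yb G[OF xdom] by simp
        show "f ((x \<circ> s) n) ((v \<circ> s) n) \<le> 0" if "f \<in> F" for f n
          using that v[of "s n"] G[OF xdomn[of "s n"]] by simp
      qed (use W(1) xs s(2) in auto)
      then show ?thesis using G[OF xdom] by simp
    qed

    \<comment> \<open>Uniform estimates near the cluster point\<close>
    then have vbW: "(xb, vb) \<in> W" using W(2) by auto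
    have nhdsW: "(q \<longlongrightarrow> q (xb, vb)) (nhds (xb, vb))" if "continuous_on W q"
      for q :: "(real^'n) \<times> (real^'m) \<Rightarrow> 'c::topological_space"
      using that W(1) vbW by (simp add: continuous_on_eq_continuous_at continuous_at tendsto_at_iff_tendsto_nhds)
    obtain M where M: "M > 0" and evM: "\<forall>\<^sub>F (x, y) in nhds (xb, vb). x \<in> domG h l p \<longrightarrow>
      (\<forall>A c. A \<subseteq> active h l xb vb \<longrightarrow> (\<forall>i\<in>A. 0 \<le> c i) \<longrightarrow>
        (\<exists>K\<subseteq>A. \<exists>d. (\<forall>i\<in>K. 0 \<le> d i) \<and>
          (\<Sum>i\<in>K \<union> J. d i *\<^sub>R ygrad h i x y) = (\<Sum>i\<in>A \<union> J. c i *\<^sub>R ygrad h i x y) \<and>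
          (\<Sum>i\<in>K \<union> J. \<bar>d i\<bar>) \<le> M * norm (\<Sum>i\<in>A \<union> J. c i *\<^sub>R ygrad h i x y)))"
    proof -
      have "((\<lambda>(x, y). ygrad h i x y) \<longlongrightarrow> ygrad h i xb vb) (nhds (xb, vb))" if "i \<in> {1..p}" for i
        using nhdsW[OF Wgrad[of i]] that IJ by simp
      then show ?thesis
        by (rule exE[OF RCPLD_multiplier_bound[OF lp bspec[OF rcpld vb] xdom]], unfold J_def[symmetric])
           (assumption, elim conjE, rule that)
    qed
    \<comment> \<open>Constraints inactive at \<open>vb\<close> stay negative nearby, so an
      inequality violated at a nearby point is active at \<open>vb\<close>, as the multiplier bound
      demands.\<close>
    have evact: "\<forall>\<^sub>F q in nhds (xb, vb). \<forall>i\<in>I - active h l xb vb. H i (fst q) (snd q) < 0"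
    proof (rule eventually_ball_finite)
      show "\<forall>i\<in>I - active h l xb vb. \<forall>\<^sub>F q in nhds (xb, vb). H i (fst q) (snd q) < 0"
      proof
        fix i assume i: "i \<in> I - active h l xb vb"
        have "H i xb vb \<noteq> 0" "H i xb vb \<le> 0"
          using i vb hH[OF xdom, of i vb] unfolding Gam_eq[OF xdom]
          by (auto simp: active_def I_def zero_ereal_def)
        moreover have "((\<lambda>(x, y). H i x y) \<longlongrightarrow> H i xb vb) (nhds (xb, vb))"
          using nhdsW[OF WcontH[of i]] i by simp
        ultimately show "\<forall>\<^sub>F q in nhds (xb, vb). H i (fst q) (snd q) < 0"
          using order_tendstoD(2)[of "\<lambda>(x, y). H i x y" "H i xb vb" "nhds (xb, vb)" 0]
          by (simp add: case_prod_beta')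
      qed
    qed (use fin in simp)
    have "\<forall>\<^sub>F q in nhds (xb, vb). q \<in> W" using W(1) vbW by (rule eventually_nhds_in_open)
    from eventually_conj[OF this eventually_conj[OF evact evM]]
    obtain N where N: "open N" "(xb, vb) \<in> N" and Nall: "\<forall>q\<in>N. q \<in> W \<and>
      (\<forall>i\<in>I - active h l xb vb. H i (fst q) (snd q) < 0) \<and>
      (fst q \<in> domG h l p \<longrightarrow>
      (\<forall>A c. A \<subseteq> active h l xb vb \<longrightarrow> (\<forall>i\<in>A. 0 \<le> c i) \<longrightarrow>
        (\<exists>K\<subseteq>A. \<exists>d. (\<forall>i\<in>K. 0 \<le> d i) \<and>
          (\<Sum>i\<in>K \<union> J. d i *\<^sub>R ygrad h i (fst q) (snd q)) = (\<Sum>i\<in>A \<union> J. c i *\<^sub>R ygrad h i (fst q) (snd q)) \<and>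
          (\<Sum>i\<in>K \<union> J. \<bar>d i\<bar>) \<le> M * norm (\<Sum>i\<in>A \<union> J. c i *\<^sub>R ygrad h i (fst q) (snd q)))))"
      unfolding eventually_nhds case_prod_beta' by (elim exE conjE)
    note NW = Nall[THEN bspec, THEN conjunct1]
      and Nact = Nall[THEN bspec, THEN conjunct2, THEN conjunct1, THEN bspec]
      and NM = Nall[THEN bspec, THEN conjunct2, THEN conjunct2, THEN mp, THEN spec, THEN spec, THEN mp, THEN mp]
    have "((\<lambda>n. (x (s n), v (s n))) \<longlongrightarrow> (xb, vb)) sequentially"
      using xs s(2) by (intro tendsto_Pair) (auto simp: o_def)
    then have "\<forall>\<^sub>F n in sequentially. (x (s n), v (s n)) \<in> N"
      using N by (rule topological_tendstoD)
    then obtain n0 where n0: "\<And>n. n \<ge> n0 \<Longrightarrow> (x (s n), v (s n)) \<in> N"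
      unfolding eventually_sequentially by blast
    \<comment> \<open>The index is large enough for \<open>(x m, v m)\<close> to lie in
      \<open>N\<close> and for \<open>M \<le> n \<le> m\<close>, where \<open>m = s n\<close>. From
      here \<open>m\<close> is fixed, and only the inner sequence \<open>z m\<close> moves.\<close>
    define n where "n = max n0 (nat \<lceil>M\<rceil>)"
    define m where "m = s n"
    have mN: "(x m, v m) \<in> N" using n0[of n] by (simp add: n_def m_def)
    have "M \<le> real n" unfolding n_def by linarith
    also have "\<dots> \<le> real m" using seq_suble[OF s(1), of n] by (simp add: m_def)
    finally have Mm: "M \<le> real (Suc m)" by simp
    have "norm (y m - v m) \<le> M * r m"
    proof (rule dist_le_residual_of_multiplier_bound[where f = "\<lambda>i. H i (x m)" and z = "z m" and I = I and J = J])
      have res: "h i (x m) (y m) = ereal (H i (x m) (y m))" if "i \<in> I \<union> J" for i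
        by (rule hH[OF xdomn that])
      show "H i (x m) (y m) \<le> r m" if "i \<in> I" for i
        using residual_bounds(2)[of i l h "x m" "y m" p] that res[of i]
        unfolding r(2) by (simp add: I_def)
      show "\<bar>H i (x m) (y m)\<bar> \<le> r m" if "i \<in> J" for i
        using residual_bounds(3)[of i l p h "x m" "y m"] that res[of i]
        unfolding r(2) by (simp add: J_def)
      show "H i (x m) (v m) = 0" if "i \<in> J" for i
        using v[of m] that unfolding Gam_eq[OF xdomn] by blast
      \<comment> \<open>\<open>N\<close> is open and contains \<open>(x m, v m)\<close>, so it also
        contains \<open>(x m, z m k)\<close> for large \<open>k\<close>. All estimates on
        \<open>N\<close> then hold at the penalised minimisers, where \<open>y m - z m k\<close> has
        its stationary representation.\<close>
      have "(\<lambda>k. (x m, z m k)) \<longlonglongrightarrow> (x m, v m)" by (intro tendsto_intros z)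
      then have "\<forall>\<^sub>F k in sequentially. (x m, z m k) \<in> N"
        using N(1) mN by (rule topological_tendstoD)
      then show "\<forall>\<^sub>F k in sequentially. \<exists>K\<subseteq>I. \<exists>d g.
        (\<forall>i\<in>K \<union> J. (H i (x m) has_derivative (\<lambda>u. g i \<bullet> u)) (at (z m k))) \<and>
        (\<forall>i\<in>K. 0 \<le> d i \<and> 0 < H i (x m) (z m k)) \<and> y m - z m k = (\<Sum>i\<in>K \<union> J. d i *\<^sub>R g i) \<and>
        (\<Sum>i\<in>K \<union> J. \<bar>d i\<bar>) \<le> M * norm (y m - z m k)"
      proof (rule eventually_mono)
        fix k assume k: "(x m, z m k) \<in> N"
        let ?g = "\<lambda>i. ygrad h i (x m) (z m k)"
        have der: "\<forall>i\<in>I \<union> J. (H i (x m) has_derivative (\<lambda>u. ?g i \<bullet> u)) (at (z m k))"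
          using Wfin[OF _ NW[OF k]] unfolding H_def[abs_def] by (blast intro: ygrad_has_derivative)
        obtain A c where A: "A \<subseteq> I" "\<forall>i\<in>A. 0 \<le> c i \<and> 0 < H i (x m) (z m k)"
          and eq: "y m - z m k = (\<Sum>i\<in>A \<union> J. c i *\<^sub>R ?g i)"
          using stat[OF der] by (elim exE conjE)
        have "A \<subseteq> active h l xb vb"
          using A Nact[OF k] by fastforce
        moreover have "\<forall>i\<in>A. 0 \<le> c i" using A(2) by blast
        ultimately have "\<exists>K\<subseteq>A. \<exists>d. (\<forall>i\<in>K. 0 \<le> d i) \<and>
            (\<Sum>i\<in>K \<union> J. d i *\<^sub>R ?g i) = (\<Sum>i\<in>A \<union> J. c i *\<^sub>R ?g i) \<and>
            (\<Sum>i\<in>K \<union> J. \<bar>d i\<bar>) \<le> M * norm (\<Sum>i\<in>A \<union> J. c i *\<^sub>R ?g i)"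
          by (rule NM[OF k, of A c, unfolded fst_conv snd_conv, OF xdomn])
        then obtain K d where K: "K \<subseteq> A" and d: "\<forall>i\<in>K. 0 \<le> d i"
          "(\<Sum>i\<in>K \<union> J. d i *\<^sub>R ?g i) = y m - z m k"
          "(\<Sum>i\<in>K \<union> J. \<bar>d i\<bar>) \<le> M * norm (y m - z m k)"
          unfolding eq[symmetric] by (elim exE conjE)
        have "K \<subseteq> I" using K A(1) by blast
        moreover have "\<forall>i\<in>K. 0 \<le> d i \<and> 0 < H i (x m) (z m k)" using d(1) A(2) K by blast
        moreover have "\<forall>i\<in>K \<union> J. (H i (x m) has_derivative (\<lambda>u. ?g i \<bullet> u)) (at (z m k))"
          using der \<open>K \<subseteq> I\<close> by blast
        ultimately show "\<exists>K\<subseteq>I. \<exists>d g.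
          (\<forall>i\<in>K \<union> J. (H i (x m) has_derivative (\<lambda>u. g i \<bullet> u)) (at (z m k))) \<and>
          (\<forall>i\<in>K. 0 \<le> d i \<and> 0 < H i (x m) (z m k)) \<and> y m - z m k = (\<Sum>i\<in>K \<union> J. d i *\<^sub>R g i) \<and>
          (\<Sum>i\<in>K \<union> J. \<bar>d i\<bar>) \<le> M * norm (y m - z m k)"
          using d(2,3) by (intro exI[of _ K] exI[of _ d] exI[of _ ?g] conjI) (simp_all only:)
      qed
    qed (use fin convH concH contH xdomn z r(1) M in auto)
    \<comment> \<open>Since \<open>v m\<close> is feasible, its distance to \<open>y m\<close>
      bounds \<open>infdist\<close> from above, which contradicts \<open>bad'\<close> at
      \<open>m\<close>.\<close>
    also have "\<dots> \<le> real (Suc m) * r m" by (rule mult_right_mono[OF Mm r(1)])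
    finally have "infdist (y m) (Gam h l p (x m)) \<le> real (Suc m) * r m"
      using infdist_le[OF v[of m], of "y m"] by (simp only: dist_norm)
    with bad'[of m] show False by simp
  qed
qed

end
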